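(* Let $1<p<2$ and let $\{X_n,\, n\geqslant 1\}$ be a sequence of pairwise negatively quadrant dependent (pairwise NQD) random variables which is stochastically dominated by a random variable $X$ with $\mathbb{E}|X|^{p}<\infty$. Then $$\frac{1}{n^{1/p}\,(\mathrm{LogLog}\, n)^{2(p-1)/p}}\sum_{k=1}^{n}(X_k-\mathbb{E}\,X_k)\longrightarrow 0\quad\text{almost surely as } n\to\infty.$$
   Context: $\mathrm{LogLog}\,x:=\log\log\max\{x,\mathrm{e}^{\mathrm{e}}\}$, with $\log$ the natural logarithm. A sequence $\{X_n,\, n\geqslant1\}$ of random variables is stochastically dominated by a random variable $X$ if there is a constant $C>0$ such that $\sup_{n\geqslant 1}\mathbb{P}\{|X_n|>t\}\leqslant C\,\mathbb{P}\{|X|>t\}$ for each $t>0$. A sequence $\{X_n,\, n\geqslant 1\}$ of random variables is pairwise negatively quadrant dependent (pairwise NQD) if $\mathbb{P}\{X_k\leqslant x_k,\,X_j\leqslant x_j\}-\mathbb{P}\{X_k\leqslant x_k\}\,\mathbb{P}\{X_j\leqslant x_j\}\leqslant 0$ for all reals $x_k,x_j$ and all positive integers $k\neq j$. *)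

theory Defs
  imports "HOL-Probability.Probability"
begin

definition LogLog :: "real \<Rightarrow> real" where
  "LogLog x = ln (ln (max x (exp (exp 1))))"

text \<open>
  Sequences are indexed from 1; the value at index 0 is never used.  The supremum below is over
  a nonempty set of reals bounded above by 1 whenever the measure is a probability measure.
\<close>

definition stochastically_dominated ::
    "'a measure \<Rightarrow> (nat \<Rightarrow> 'a \<Rightarrow> real) \<Rightarrow> ('a \<Rightarrow> real) \<Rightarrow> bool" where
  "stochastically_dominated M X Y \<longleftrightarrow>
     (\<exists>C>0. \<forall>t>0. (SUP n\<in>{1..}. \<P>(\<omega> in M. \<bar>X n \<omega>\<bar> > t)) \<le> C * \<P>(\<omega> in M. \<bar>Y \<omega>\<bar> > t))"

definition pairwise_NQD :: "'a measure \<Rightarrow> (nat \<Rightarrow> 'a \<Rightarrow> real) \<Rightarrow> bool" where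
  "pairwise_NQD M X \<longleftrightarrow>
     (\<forall>k\<ge>1. \<forall>j\<ge>1. k \<noteq> j \<longrightarrow> (\<forall>x y.
        \<P>(\<omega> in M. X k \<omega> \<le> x \<and> X j \<omega> \<le> y)
          - \<P>(\<omega> in M. X k \<omega> \<le> x) * \<P>(\<omega> in M. X j \<omega> \<le> y) \<le> 0))"

end

theory Submission
  imports Defs "HOL-Real_Asymp.Real_Asymp"
begin

text \<open>Since \<open>LogLog\<close> is at least \<open>1\<close>, it suffices to prove the strong law with the smaller norming
\<open>n powr (1 / p)\<close>. Negative quadrant dependence makes bounded nondecreasing piecewise linear functions
of two different \<open>X k\<close> negatively correlated, and the truncated positive and negative parts of
\<open>X k\<close> are, up to a constant and a sign common to all \<open>k\<close>, such functions. The theorem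
therefore reduces to nonnegative \<open>Z k\<close> whose truncations at any common level are negatively
correlated, and there the variance of a sum of truncations is at most the sum of the second moments.

The difficulty is to control the maximum of the partial sums up to \<open>2 ^ m\<close> with nothing better
than pairwise information. Ordinary dyadic chaining at one truncation level sums \<open>m\<close> terms of equal
size, one per scale, and loses logarithms. The remedy is to let the level fall with
the scale: on blocks of length \<open>2 ^ i\<close> the variables are cut at
\<open>2 powr (m / p - (m - i))\<close>. Passing from scale \<open>i + 1\<close> to scale \<open>i\<close> lowers all
truncated variables, so the change of the sum over an initial piece of a block
is controlled by the whole block and by its mean (\<open>dyadic_chaining\<close>). With \<open>l = m - i\<close>,
the means contribute at most \<open>2 powr (m / p)\<close> times a multiple of \<open>2 powr (- (2 - p) * l)\<close>
times a tail of the \<open>p\<close>-th moment; the sum over \<open>l\<close> of these factors tends to \<open>0\<close>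
with \<open>m\<close> by dominated convergence (\<open>bias_tendsto_0\<close>). The block sums have second moments
which, divided by \<open>2 powr (2 * m / p)\<close> and summed over \<open>m\<close>, are also of order
\<open>2 powr (- (2 - p) * l)\<close>. Half of this decay pays for a weighted Cauchy-Schwarz inequality over
the scales, the other half keeps the sum over \<open>l\<close> finite; so the weighted energies of the blocks
have summable expectations and tend to \<open>0\<close> almost surely
(\<open>AE_weighted_energy_tendsto_0\<close>). Finally, by Borel-Cantelli, almost surely the truncation at the
top level changes none of the first \<open>2 ^ m\<close> variables once \<open>m\<close> is large.\<close>

section \<open>Covariances of ramps under negative quadrant dependence\<close>

text \<open>Inclusion-exclusion: passing to the complement of one half-line changes the sign of the covariance of the
two indicators, so passing to both complements preserves it.\<close>

lemma (in prob_space) nqd_upper_orthant: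
  fixes U V :: "'a \<Rightarrow> real"
  assumes [measurable]: "U \<in> borel_measurable M" "V \<in> borel_measurable M"
    and nqd: "\<P>(\<omega> in M. U \<omega> \<le> s \<and> V \<omega> \<le> t) \<le> \<P>(\<omega> in M. U \<omega> \<le> s) * \<P>(\<omega> in M. V \<omega> \<le> t)"
  shows "\<P>(\<omega> in M. s < U \<omega> \<and> t < V \<omega>) \<le> \<P>(\<omega> in M. s < U \<omega>) * \<P>(\<omega> in M. t < V \<omega>)"
proof -
  have U: "\<P>(\<omega> in M. s < U \<omega>) = 1 - \<P>(\<omega> in M. U \<omega> \<le> s)"
    using prob_neg[of "\<lambda>\<omega>. U \<omega> \<le> s"] by (simp add: not_le)
  have V: "\<P>(\<omega> in M. t < V \<omega>) = 1 - \<P>(\<omega> in M. V \<omega> \<le> t)"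
    using prob_neg[of "\<lambda>\<omega>. V \<omega> \<le> t"] by (simp add: not_le)
  have "\<P>(\<omega> in M. s < U \<omega> \<and> t < V \<omega>) = 1 - \<P>(\<omega> in M. U \<omega> \<le> s \<or> V \<omega> \<le> t)"
    using prob_neg[of "\<lambda>\<omega>. U \<omega> \<le> s \<or> V \<omega> \<le> t"] by (simp add: not_le)
  also have "\<P>(\<omega> in M. U \<omega> \<le> s \<or> V \<omega> \<le> t)
      = \<P>(\<omega> in M. U \<omega> \<le> s) + \<P>(\<omega> in M. V \<omega> \<le> t) - \<P>(\<omega> in M. U \<omega> \<le> s \<and> V \<omega> \<le> t)"
  proof -
    have "prob ({\<omega> \<in> space M. U \<omega> \<le> s} \<union> {\<omega> \<in> space M. V \<omega> \<le> t}) =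
        prob {\<omega> \<in> space M. U \<omega> \<le> s} + prob {\<omega> \<in> space M. V \<omega> \<le> t}
         - prob ({\<omega> \<in> space M. U \<omega> \<le> s} \<inter> {\<omega> \<in> space M. V \<omega> \<le> t})"
      by (subst finite_measure_Union') (auto simp: finite_measure_Diff' Int_commute)
    moreover have "{\<omega> \<in> space M. U \<omega> \<le> s} \<union> {\<omega> \<in> space M. V \<omega> \<le> t} = {\<omega> \<in> space M. U \<omega> \<le> s \<or> V \<omega> \<le> t}"
      "{\<omega> \<in> space M. U \<omega> \<le> s} \<inter> {\<omega> \<in> space M. V \<omega> \<le> t} = {\<omega> \<in> space M. U \<omega> \<le> s \<and> V \<omega> \<le> t}"
      by auto
    ultimately show ?thesis by simp
  qed
  finally show ?thesis using nqd unfolding U V by (simp add: algebra_simps)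
qed

definition ramp :: "real \<Rightarrow> real \<Rightarrow> real \<Rightarrow> real" where
  "ramp a b x = max 0 (min (x - a) (b - a))"

lemma ramp_measurable [measurable]: "ramp a b \<in> borel_measurable borel"
  unfolding ramp_def[abs_def] by measurable

lemma ramp_nonneg: "0 \<le> ramp a b x"
  by (simp add: ramp_def)

lemma ramp_le: "a \<le> b \<Longrightarrow> ramp a b x \<le> b - a"
  by (simp add: ramp_def)

text \<open>Writing a ramp as a superposition of indicators of upper half-lines reduces the covariance of two ramps
to probabilities of upper orthants.\<close>

lemma ramp_layer_cake:
  "ennreal (ramp a b x) = (\<integral>\<^sup>+s. indicator {a..<b} s * indicator {..<x} s \<partial>lborel)"
proof -
  have "(\<integral>\<^sup>+s. indicator {a..<b} s * indicator {..<x} s \<partial>lborel)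
      = (\<integral>\<^sup>+s. indicator {a..<min x b} s \<partial>lborel)"
    by (intro nn_integral_cong) (auto simp: indicator_def)
  also have "\<dots> = emeasure lborel {a..<min x b}"
    by simp
  also have "\<dots> = ennreal (ramp a b x)"
    by (cases "a \<le> min x b") (auto simp: ramp_def min_def max_def)
  finally show ?thesis ..
qed

lemma (in prob_space) integrable_ramp:
  assumes [measurable]: "U \<in> borel_measurable M" and "a \<le> b"
  shows "integrable M (\<lambda>\<omega>. ramp a b (U \<omega>))"
  using ramp_le[OF \<open>a \<le> b\<close>] ramp_nonneg by (intro integrable_const_bound[where B="b - a"]) auto

lemma (in prob_space) integrable_ramp_mult:
  assumes [measurable]: "U \<in> borel_measurable M" "V \<in> borel_measurable M" and "a \<le> b"
  shows "integrable M (\<lambda>\<omega>. ramp a b (U \<omega>) * ramp a b (V \<omega>))"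
  using ramp_le[OF \<open>a \<le> b\<close>] ramp_nonneg \<open>a \<le> b\<close>
  by (intro integrable_const_bound[where B="(b - a) * (b - a)"]) (auto intro!: mult_mono AE_I2 simp: abs_mult)

text \<open>This is an instance of Hoeffding's covariance identity: by Fubini the covariance of two ramps is the integral,
over all pairs of thresholds, of the covariances of the corresponding indicators, and none of these is
positive. Both sides are computed as iterated integrals in \<open>ennreal\<close>, which spares all
integrability side conditions.\<close>

lemma (in prob_space) nqd_ramp_covariance:
  fixes U V :: "'a \<Rightarrow> real"
  assumes [measurable]: "U \<in> borel_measurable M" "V \<in> borel_measurable M"
    and nqd: "\<And>s t. \<P>(\<omega> in M. U \<omega> \<le> s \<and> V \<omega> \<le> t) \<le> \<P>(\<omega> in M. U \<omega> \<le> s) * \<P>(\<omega> in M. V \<omega> \<le> t)"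
    and ab: "a \<le> b"
  shows "expectation (\<lambda>\<omega>. ramp a b (U \<omega>) * ramp a b (V \<omega>))
       \<le> expectation (\<lambda>\<omega>. ramp a b (U \<omega>)) * expectation (\<lambda>\<omega>. ramp a b (V \<omega>))"
proof -
  interpret L: pair_sigma_finite lborel M
    by (simp add: pair_sigma_finite_def sigma_finite_lborel sigma_finite_measure_axioms)
  define I where "I = (\<lambda>s. indicator {a..<b} s :: ennreal)"
  have [measurable]: "I \<in> borel_measurable borel"
    by (simp add: I_def)
  define J :: "real \<Rightarrow> real \<Rightarrow> ennreal" where "J = (\<lambda>s x. if s < x then 1 else 0)"
  have [measurable]: "(\<lambda>(s, x). J s x) \<in> borel_measurable (borel \<Otimes>\<^sub>M borel)"
    unfolding J_def by measurable
  have lc: "ennreal (ramp a b x) = (\<integral>\<^sup>+s. I s * J s x \<partial>lborel)" for x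
    unfolding ramp_layer_cake I_def J_def by (intro nn_integral_cong) (auto simp: indicator_def)
  have prob_J: "(\<integral>\<^sup>+\<omega>. J s (W \<omega>) \<partial>M) = ennreal (\<P>(\<omega> in M. s < W \<omega>))"
    if [measurable]: "W \<in> borel_measurable M" for W s
  proof -
    have "(\<integral>\<^sup>+\<omega>. J s (W \<omega>) \<partial>M) = (\<integral>\<^sup>+\<omega>. indicator {\<omega> \<in> space M. s < W \<omega>} \<omega> \<partial>M)"
      by (intro nn_integral_cong) (auto simp: J_def)
    then show ?thesis by (simp add: emeasure_eq_measure)
  qed
  have single: "(\<integral>\<^sup>+\<omega>. ennreal (ramp a b (W \<omega>)) \<partial>M) = (\<integral>\<^sup>+s. I s * ennreal (\<P>(\<omega> in M. s < W \<omega>)) \<partial>lborel)"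
    if [measurable]: "W \<in> borel_measurable M" for W
    unfolding lc by (subst L.Fubini') (auto simp: nn_integral_cmult prob_J)
  have joint: "(\<integral>\<^sup>+\<omega>. J s (U \<omega>) * J t (V \<omega>) \<partial>M) = ennreal (\<P>(\<omega> in M. s < U \<omega> \<and> t < V \<omega>))" for s t
  proof -
    have "(\<integral>\<^sup>+\<omega>. J s (U \<omega>) * J t (V \<omega>) \<partial>M) = (\<integral>\<^sup>+\<omega>. indicator {\<omega> \<in> space M. s < U \<omega> \<and> t < V \<omega>} \<omega> \<partial>M)"
      by (intro nn_integral_cong) (auto simp: J_def)
    then show ?thesis by (simp add: emeasure_eq_measure)
  qed
  have "(\<integral>\<^sup>+\<omega>. ennreal (ramp a b (U \<omega>)) * ennreal (ramp a b (V \<omega>)) \<partial>M)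
      = (\<integral>\<^sup>+\<omega>. \<integral>\<^sup>+s. I s * (J s (U \<omega>) * ennreal (ramp a b (V \<omega>))) \<partial>lborel \<partial>M)"
    by (subst lc) (simp add: nn_integral_multc[symmetric] mult.assoc)
  also have "\<dots> = (\<integral>\<^sup>+s. I s * (\<integral>\<^sup>+\<omega>. J s (U \<omega>) * ennreal (ramp a b (V \<omega>)) \<partial>M) \<partial>lborel)"
    by (subst L.Fubini') (auto simp: nn_integral_cmult)
  also have "\<dots> = (\<integral>\<^sup>+s. I s * (\<integral>\<^sup>+\<omega>. \<integral>\<^sup>+t. I t * (J s (U \<omega>) * J t (V \<omega>)) \<partial>lborel \<partial>M) \<partial>lborel)"
    unfolding lc by (simp add: nn_integral_cmult[symmetric] ac_simps)
  also have "\<dots> = (\<integral>\<^sup>+s. I s * (\<integral>\<^sup>+t. I t * ennreal (\<P>(\<omega> in M. s < U \<omega> \<and> t < V \<omega>)) \<partial>lborel) \<partial>lborel)"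
    by (subst L.Fubini') (auto simp: nn_integral_cmult joint)
  also have "\<dots> \<le> (\<integral>\<^sup>+s. I s * (\<integral>\<^sup>+t. I t * (ennreal (\<P>(\<omega> in M. s < U \<omega>)) * ennreal (\<P>(\<omega> in M. t < V \<omega>))) \<partial>lborel) \<partial>lborel)"
    by (intro nn_integral_mono mult_left_mono)
       (auto simp: ennreal_mult[symmetric] intro!: ennreal_leI nqd_upper_orthant nqd)
  also have "\<dots> = (\<integral>\<^sup>+s. I s * ennreal (\<P>(\<omega> in M. s < U \<omega>)) \<partial>lborel)
      * (\<integral>\<^sup>+t. I t * ennreal (\<P>(\<omega> in M. t < V \<omega>)) \<partial>lborel)"
  proof -
    have [measurable]: "(\<lambda>s. ennreal (\<P>(\<omega> in M. s < W \<omega>))) \<in> borel_measurable borel"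
      if [measurable]: "W \<in> borel_measurable M" for W :: "'a \<Rightarrow> real"
    proof -
      have "(\<lambda>s. \<integral>\<^sup>+\<omega>. J s (W \<omega>) \<partial>M) \<in> borel_measurable borel"
        by measurable
      then show ?thesis by (simp add: prob_J)
    qed
    have "(\<integral>\<^sup>+s. I s * (\<integral>\<^sup>+t. I t * (f s * g t) \<partial>lborel) \<partial>lborel)
        = (\<integral>\<^sup>+s. I s * f s \<partial>lborel) * (\<integral>\<^sup>+t. I t * g t \<partial>lborel)"
      if [measurable]: "f \<in> borel_measurable borel" "g \<in> borel_measurable borel" for f g
    proof -
      have "(\<integral>\<^sup>+t. I t * (f s * g t) \<partial>lborel) = f s * (\<integral>\<^sup>+t. I t * g t \<partial>lborel)" for s
        by (subst nn_integral_cmult[symmetric]) (auto simp: ac_simps)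
      then show ?thesis
        by (simp add: nn_integral_multc[symmetric] mult.assoc)
    qed
    then show ?thesis by simp
  qed
  also have "\<dots> = (\<integral>\<^sup>+\<omega>. ennreal (ramp a b (U \<omega>)) \<partial>M) * (\<integral>\<^sup>+\<omega>. ennreal (ramp a b (V \<omega>)) \<partial>M)"
    by (simp add: single)
  finally have "(\<integral>\<^sup>+\<omega>. ennreal (ramp a b (U \<omega>) * ramp a b (V \<omega>)) \<partial>M)
      \<le> (\<integral>\<^sup>+\<omega>. ennreal (ramp a b (U \<omega>)) \<partial>M) * (\<integral>\<^sup>+\<omega>. ennreal (ramp a b (V \<omega>)) \<partial>M)"
    by (simp add: ennreal_mult ramp_nonneg)
  then show ?thesis
    using ab by (simp add: nn_integral_eq_integral integrable_ramp integrable_ramp_mult ramp_nonneg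
        ennreal_mult[symmetric] integral_nonneg_AE)
qed

section \<open>Moments under a tail comparison\<close>

text \<open>By the layer cake formula an expectation of \<open>h\<close> is the integral of \<open>P (s < h W)\<close> over \<open>s > 0\<close>.
For a continuous nondecreasing \<open>h\<close> the event \<open>s < h W\<close> is again a tail event of \<open>W\<close>, at the
threshold \<open>Sup {x. h x \<le> s}\<close>, so the tail comparison applies to the integrand.\<close>

lemma (in prob_space) expectation_le_of_tail_le:
  fixes Z Y :: "'a \<Rightarrow> real" and h :: "real \<Rightarrow> real"
  assumes [measurable]: "Z \<in> borel_measurable M" "Y \<in> borel_measurable M"
    and nonneg: "\<And>\<omega>. 0 \<le> Z \<omega>" "\<And>\<omega>. 0 \<le> Y \<omega>"
    and "0 \<le> C" and tail: "\<And>t. 0 < t \<Longrightarrow> \<P>(\<omega> in M. t < Z \<omega>) \<le> C * \<P>(\<omega> in M. t < Y \<omega>)"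
    and h: "continuous_on UNIV h" "mono h" "h 0 = 0"
    and int: "integrable M (\<lambda>\<omega>. h (Y \<omega>))"
  shows "integrable M (\<lambda>\<omega>. h (Z \<omega>))"
    and "expectation (\<lambda>\<omega>. h (Z \<omega>)) \<le> C * expectation (\<lambda>\<omega>. h (Y \<omega>))"
proof -
  interpret L: pair_sigma_finite lborel M
    by (simp add: pair_sigma_finite_def sigma_finite_lborel sigma_finite_measure_axioms)
  have [measurable]: "h \<in> borel_measurable borel"
    using h(1) by (rule borel_measurable_continuous_onI)
  have h_nonneg: "0 \<le> h x" if "0 \<le> x" for x
    using monoD[OF h(2) that] h(3) by simp
  have lc: "(\<integral>\<^sup>+\<omega>. ennreal (h (W \<omega>)) \<partial>M)
      = (\<integral>\<^sup>+s. indicator {0<..} s * ennreal (\<P>(\<omega> in M. s < h (W \<omega>))) \<partial>lborel)"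
    if [measurable]: "W \<in> borel_measurable M" and W: "\<And>\<omega>. 0 \<le> W \<omega>" for W
  proof -
    have "ennreal (h (W \<omega>)) = (\<integral>\<^sup>+s. indicator {0<..} s * (if s < h (W \<omega>) then 1 else 0) \<partial>lborel)" for \<omega>
    proof -
      have "(\<integral>\<^sup>+s. indicator {0<..} s * (if s < h (W \<omega>) then 1 else 0) \<partial>lborel)
          = (\<integral>\<^sup>+s. indicator {0<..<h (W \<omega>)} s \<partial>lborel)"
        by (intro nn_integral_cong) (auto simp: indicator_def)
      then show ?thesis using h_nonneg[OF W] by simp
    qed
    then have "(\<integral>\<^sup>+\<omega>. ennreal (h (W \<omega>)) \<partial>M)
        = (\<integral>\<^sup>+s. indicator {0<..} s * (\<integral>\<^sup>+\<omega>. (if s < h (W \<omega>) then 1 else 0) \<partial>M) \<partial>lborel)"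
      by (simp, subst L.Fubini') (auto simp: nn_integral_cmult)
    also have "\<dots> = (\<integral>\<^sup>+s. indicator {0<..} s * ennreal (\<P>(\<omega> in M. s < h (W \<omega>))) \<partial>lborel)"
    proof (rule nn_integral_cong)
      fix s :: real
      have "(\<integral>\<^sup>+\<omega>. (if s < h (W \<omega>) then 1 else 0) \<partial>M)
          = (\<integral>\<^sup>+\<omega>. indicator {\<omega> \<in> space M. s < h (W \<omega>)} \<omega> \<partial>M)"
        by (intro nn_integral_cong) auto
      then show "indicator {0<..} s * (\<integral>\<^sup>+\<omega>. (if s < h (W \<omega>) then 1 else 0) \<partial>M)
          = indicator {0<..} s * ennreal (\<P>(\<omega> in M. s < h (W \<omega>)))"
        by (simp add: emeasure_eq_measure)
    qed
    finally show ?thesis .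
  qed
  have htail: "\<P>(\<omega> in M. s < h (Z \<omega>)) \<le> C * \<P>(\<omega> in M. s < h (Y \<omega>))" if "0 < s" for s
  proof (cases "\<exists>x\<ge>0. s < h x")
    case False
    then have "{\<omega> \<in> space M. s < h (Z \<omega>)} = {}" using nonneg by auto
    then show ?thesis using \<open>0 \<le> C\<close> by (simp only: measure_empty) simp
  next
    case True
    then obtain x1 where x1: "0 \<le> x1" "s < h x1" by auto
    define S where "S = {x. h x \<le> s}"
    have S_bdd: "bdd_above S"
    proof (rule bdd_aboveI)
      fix x assume "x \<in> S"
      show "x \<le> x1"
      proof (rule ccontr)
        assume "\<not> x \<le> x1"
        then have "h x1 \<le> h x" using h(2) by (simp add: monoD)
        with x1 \<open>x \<in> S\<close> show False by (simp add: S_def)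
      qed
    qed
    have "closed S"
      unfolding S_def by (intro closed_Collect_le h(1) continuous_on_const)
    moreover have "S \<noteq> {}" using h(3) \<open>0 < s\<close> by (auto simp: S_def intro!: exI[of _ 0])
    ultimately have "Sup S \<in> S" using S_bdd by (simp add: closed_contains_Sup)
    \<comment> \<open>the tail comparison needs a positive threshold: by the intermediate value theorem S has a positive point\<close>
    obtain x0 where x0: "0 \<le> x0" "h x0 = s / 2"
      using IVT'[of h 0 "s/2" x1] h(3) x1 \<open>0 < s\<close> continuous_on_subset[OF h(1)] by auto
    then have "x0 \<noteq> 0" "x0 \<in> S" using h(3) \<open>0 < s\<close> by (auto simp: S_def)
    then have "0 < Sup S" using x0 cSup_upper[OF _ S_bdd] by fastforce
    have eq: "s < h x \<longleftrightarrow> Sup S < x" for x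
    proof
      assume "s < h x"
      with \<open>Sup S \<in> S\<close> monoD[OF h(2), of x "Sup S"] show "Sup S < x" by (force simp: S_def not_le[symmetric])
    next
      assume "Sup S < x"
      then have "x \<notin> S" using cSup_upper[OF _ S_bdd] by fastforce
      then show "s < h x" by (simp add: S_def)
    qed
    show ?thesis unfolding eq using tail[OF \<open>0 < Sup S\<close>] .
  qed
  have "(\<integral>\<^sup>+\<omega>. ennreal (h (Z \<omega>)) \<partial>M)
      \<le> (\<integral>\<^sup>+s. ennreal C * (indicator {0<..} s * ennreal (\<P>(\<omega> in M. s < h (Y \<omega>)))) \<partial>lborel)"
    unfolding lc[OF assms(1) nonneg(1)]
    using htail \<open>0 \<le> C\<close>
    by (intro nn_integral_mono) (auto simp: indicator_def ennreal_mult[symmetric] intro!: ennreal_leI)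
  also have "\<dots> = ennreal C * (\<integral>\<^sup>+\<omega>. ennreal (h (Y \<omega>)) \<partial>M)"
    unfolding lc[OF assms(2) nonneg(2)] by (rule nn_integral_cmult) measurable
  also have "\<dots> = ennreal (C * expectation (\<lambda>\<omega>. h (Y \<omega>)))"
    using int \<open>0 \<le> C\<close> h_nonneg nonneg by (simp add: nn_integral_eq_integral ennreal_mult integral_nonneg_AE)
  finally have le: "(\<integral>\<^sup>+\<omega>. ennreal (h (Z \<omega>)) \<partial>M) \<le> ennreal (C * expectation (\<lambda>\<omega>. h (Y \<omega>)))" .
  show Zint: "integrable M (\<lambda>\<omega>. h (Z \<omega>))"
    using le h_nonneg nonneg
    by (intro integrableI_nonneg) (auto intro: le_less_trans)
  show "expectation (\<lambda>\<omega>. h (Z \<omega>)) \<le> C * expectation (\<lambda>\<omega>. h (Y \<omega>))"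
    using le Zint h_nonneg nonneg \<open>0 \<le> C\<close>
    by (simp add: nn_integral_eq_integral integral_nonneg_AE)
qed

section \<open>Chaining along dyadic blocks\<close>

text \<open>Here \<open>d i k\<close> stands for the centred \<open>k\<close>-th variable truncated at the level that belongs to blocks
of length \<open>2 ^ i\<close>, and \<open>e i k\<close> for the mean of the increment of the truncation between two
consecutive levels. An initial piece of a block at scale \<open>i + 1\<close> is first moved to the truncation
level of scale \<open>i\<close>; the error is a sum of nonnegative increments minus their means, and hence is
bounded from above by the increments over the whole block and from below by minus the means. The whole
block costs \<open>G (Suc i) + 2 * G i\<close>, since it consists of two blocks of scale \<open>i\<close>. What remains is an
initial piece of one of these two blocks, preceded by at most one full block, which costs a third \<open>G i\<close>.\<close>

lemma dyadic_chaining: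
  fixes d e :: "nat \<Rightarrow> nat \<Rightarrow> real" and G E :: "nat \<Rightarrow> real"
  assumes e_nonneg: "\<And>i k. 0 \<le> e i k"
    and incr: "\<And>i k. - e i k \<le> d (Suc i) k - d i k"
    and G: "\<And>i j. i \<le> m \<Longrightarrow> Suc j * 2 ^ i \<le> N \<Longrightarrow> \<bar>\<Sum>k\<in>{j * 2 ^ i..<Suc j * 2 ^ i}. d i k\<bar> \<le> G i"
    and E: "\<And>i j. i < m \<Longrightarrow> Suc j * 2 ^ Suc i \<le> N \<Longrightarrow> (\<Sum>k\<in>{j * 2 ^ Suc i..<Suc j * 2 ^ Suc i}. e i k) \<le> E i"
    and "i \<le> m" "Suc j * 2 ^ i \<le> N" "j * 2 ^ i \<le> n" "n \<le> Suc j * 2 ^ i"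
  shows "\<bar>\<Sum>k\<in>{j * 2 ^ i..<n}. d i k\<bar> \<le> G 0 + (\<Sum>l<i. G (Suc l) + 3 * G l + E l)"
  using assms(5-8)
proof (induction i arbitrary: j n)
  case 0
  have G0: "\<bar>\<Sum>k\<in>{j..<Suc j}. d 0 k\<bar> \<le> G 0" using G[of 0 j] 0 by simp
  consider "n = j" | "n = Suc j" using 0 by force
  then show ?case
  proof cases
    case 1
    then show ?thesis using G0 by simp
  next
    case 2
    then show ?thesis using G0 by simp
  qed
next
  case (Suc i)
  define a c b where "a = j * 2 ^ Suc i" and "c = Suc (2 * j) * 2 ^ i" and "b = Suc j * 2 ^ Suc i"
  have acb: "a \<le> c" "c \<le> b" "a = (2 * j) * 2 ^ i" "b = Suc (Suc (2 * j)) * 2 ^ i"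
    by (simp_all add: a_def b_def c_def)
  have "a \<le> n" "n \<le> b" "b \<le> N" using Suc.prems by (simp_all add: a_def b_def)
  have i: "i \<le> m" "i < m" "Suc i \<le> m" using Suc.prems by simp_all
  define R where "R = G 0 + (\<Sum>l<i. G (Suc l) + 3 * G l + E l)"
  have left: "\<bar>\<Sum>k\<in>{a..<c}. d i k\<bar> \<le> G i"
    using G[OF i(1), of "2 * j"] acb \<open>b \<le> N\<close> unfolding c_def acb(3) by simp
  have right: "\<bar>\<Sum>k\<in>{c..<b}. d i k\<bar> \<le> G i"
    using G[OF i(1), of "Suc (2 * j)"] \<open>b \<le> N\<close> unfolding c_def acb(4) by simp
  have whole: "\<bar>\<Sum>k\<in>{a..<b}. d (Suc i) k\<bar> \<le> G (Suc i)"
    using G[OF i(3), of j] \<open>b \<le> N\<close> unfolding a_def b_def by simp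
  have Eb: "(\<Sum>k\<in>{a..<b}. e i k) \<le> E i"
    using E[OF i(2), of j] \<open>b \<le> N\<close> unfolding a_def b_def by simp
  have "0 \<le> G i" using left by linarith
  \<comment> \<open>the piece is either inside the left half, or the left half plus a piece of the right half\<close>
  have lower_level: "\<bar>\<Sum>k\<in>{a..<n}. d i k\<bar> \<le> G i + R"
  proof (cases "n \<le> c")
    case True
    have "\<bar>\<Sum>k\<in>{a..<n}. d i k\<bar> \<le> R"
      using Suc.IH[of "2 * j" n] i True acb \<open>a \<le> n\<close> \<open>b \<le> N\<close> unfolding c_def acb(3) R_def by simp
    then show ?thesis using \<open>0 \<le> G i\<close> by linarith
  next
    case False
    have "\<bar>\<Sum>k\<in>{c..<n}. d i k\<bar> \<le> R"
      using Suc.IH[of "Suc (2 * j)" n] i False \<open>n \<le> b\<close> \<open>b \<le> N\<close> unfolding c_def acb(4) R_def by simp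
    moreover have "(\<Sum>k\<in>{a..<n}. d i k) = (\<Sum>k\<in>{a..<c}. d i k) + (\<Sum>k\<in>{c..<n}. d i k)"
      using False acb by (simp add: sum.atLeastLessThan_concat)
    ultimately show ?thesis using left by linarith
  qed
  define u where "u k = d (Suc i) k - d i k" for k
  have u_block: "\<bar>\<Sum>k\<in>{a..<b}. u k\<bar> \<le> G (Suc i) + 2 * G i"
  proof -
    have "(\<Sum>k\<in>{a..<b}. d i k) = (\<Sum>k\<in>{a..<c}. d i k) + (\<Sum>k\<in>{c..<b}. d i k)"
      using acb by (simp add: sum.atLeastLessThan_concat)
    then show ?thesis using left right whole unfolding u_def sum_subtractf by linarith
  qed
  \<comment> \<open>u + e is an increment of the truncation, hence nonnegative\<close>
  have ue: "0 \<le> u k + e i k" for k using incr[of i k] by (simp add: u_def)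
  have mono1: "(\<Sum>k\<in>{a..<n}. u k + e i k) \<le> (\<Sum>k\<in>{a..<b}. u k + e i k)"
    using \<open>n \<le> b\<close> ue by (intro sum_mono2) auto
  have mono2: "(\<Sum>k\<in>{a..<n}. e i k) \<le> (\<Sum>k\<in>{a..<b}. e i k)"
    using \<open>n \<le> b\<close> e_nonneg by (intro sum_mono2) auto
  have nn: "0 \<le> (\<Sum>k\<in>{a..<n}. u k + e i k)" "0 \<le> (\<Sum>k\<in>{a..<n}. e i k)"
    by (intro sum_nonneg ue e_nonneg)+
  have "\<bar>\<Sum>k\<in>{a..<n}. u k\<bar> \<le> G (Suc i) + 2 * G i + E i"
    using mono1 mono2 nn u_block Eb unfolding sum.distrib by linarith
  moreover have "(\<Sum>k\<in>{a..<n}. d (Suc i) k) = (\<Sum>k\<in>{a..<n}. d i k) + (\<Sum>k\<in>{a..<n}. u k)"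
    unfolding u_def sum_subtractf by simp
  ultimately have "\<bar>\<Sum>k\<in>{a..<n}. d (Suc i) k\<bar> \<le> R + (G (Suc i) + 3 * G i + E i)"
    using lower_level by linarith
  then show ?case unfolding R_def a_def by (simp add: add.assoc)
qed

section \<open>Dyadic sums of truncated squares\<close>

lemma sum_geometric_le:
  fixes r :: real
  assumes "0 \<le> r" "r < 1"
  shows "(\<Sum>l<n. r ^ l) \<le> 1 / (1 - r)"
  using sum_le_suminf[of "\<lambda>l. r ^ l" "{..<n}"] assms suminf_geometric[of r]
  by (simp add: summable_geometric)

text \<open>The two expressions under the minimum agree at \<open>2 ^ m = w\<close>. Below this point the sum is dominated by
its last term, above it by its first one, and both are of order \<open>w\<close>.\<close>

lemma sum_min_dyadic_le:
  fixes w \<theta> :: real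
  assumes "0 < w" "0 < \<theta>"
  shows "(\<Sum>m<n. min (2 ^ m) (w * (w / 2 ^ m) powr \<theta>)) \<le> (2 + 1 / (1 - 2 powr - \<theta>)) * w"
proof -
  define r where "r = (2::real) powr - \<theta>"
  have r: "0 \<le> r" "r < 1" using assms by (auto simp: r_def powr_less_one)
  obtain m1 :: nat where m1: "w < 2 ^ m1" using real_arch_pow[of 2 w] by auto
  \<comment> \<open>the index at which the two expressions under the minimum change roles\<close>
  define m0 where "m0 = (LEAST m. w < 2 ^ m)"
  have m0: "w < 2 ^ m0" unfolding m0_def using m1 by (rule LeastI)
  have min_m0: "2 ^ m \<le> w" if "m < m0" for m
    using not_less_Least[of m "\<lambda>m. w < 2 ^ m"] that by (auto simp: m0_def)
  have low: "(\<Sum>m<m0. 2 ^ m) \<le> 2 * w"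
  proof (cases m0)
    case 0
    then show ?thesis using assms by simp
  next
    case (Suc m')
    have "(\<Sum>m<m0. 2 ^ m) = (2::real) ^ m0 - 1" by (simp add: sum_gp_strict)
    then show ?thesis using min_m0[of m'] Suc by simp
  qed
  have high: "w * (w / 2 ^ (m0 + l)) powr \<theta> \<le> w * r ^ l" for l
  proof -
    have "(w / 2 ^ (m0 + l)) powr \<theta> \<le> (1 / 2 ^ l) powr \<theta>"
      using m0 assms by (intro powr_mono2) (auto simp: power_add field_simps)
    also have "\<dots> = r ^ l"
      by (simp add: r_def powr_divide powr_minus powr_realpow[symmetric] powr_powr powr_power field_simps)
    finally show ?thesis using assms by simp
  qed
  have split: "(\<Sum>m<m0 + n. f m) = (\<Sum>m<m0. f m) + (\<Sum>l<n. f (m0 + l))" for f :: "nat \<Rightarrow> real"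
    by (induction n) simp_all
  have "(\<Sum>m<n. min (2 ^ m) (w * (w / 2 ^ m) powr \<theta>))
      \<le> (\<Sum>m<m0 + n. min (2 ^ m) (w * (w / 2 ^ m) powr \<theta>))"
    using assms by (intro sum_mono2) auto
  also have "\<dots> = (\<Sum>m<m0. min (2 ^ m) (w * (w / 2 ^ m) powr \<theta>))
      + (\<Sum>l<n. min (2 ^ (m0 + l)) (w * (w / 2 ^ (m0 + l)) powr \<theta>))"
    by (rule split)
  also have "\<dots> \<le> (\<Sum>m<m0. 2 ^ m) + (\<Sum>l<n. w * r ^ l)"
    using high by (intro add_mono sum_mono) (auto intro: min.coboundedI2)
  also have "\<dots> \<le> 2 * w + w * (1 / (1 - r))"
    unfolding sum_distrib_left[symmetric] using low sum_geometric_le[OF r, of n] assms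
    by (intro add_mono mult_left_mono) auto
  finally show ?thesis by (simp add: r_def algebra_simps)
qed

lemma two_power_eq_powr: "(2::real) ^ n = 2 powr real n"
  by (simp add: powr_realpow)

lemma two_powr_power: "(2 powr x) ^ n = 2 powr (x * real n)" for x :: real
  by (simp add: powr_power mult.commute)

text \<open>This deterministic inequality makes the block energies summable. For fixed \<open>l = m - i\<close>, put
\<open>w = (y * 2 ^ l) powr p\<close>: the two bounds \<open>y\<close> and \<open>2 powr (m / p - l)\<close> for the truncated value
become the two terms of \<open>sum_min_dyadic_le\<close>, up to the factor \<open>2 powr (- 2 * l)\<close>. The sum over \<open>m\<close>
is thus a multiple of \<open>y powr p * 2 powr (- (2 - p) * l)\<close>, and the weight
\<open>2 powr ((2 - p) / 2 * l)\<close> uses up only half of this decay.\<close>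

lemma sum_dyadic_truncated_squares_le:
  fixes p :: real
  assumes p: "1 < p" "p < 2"
  obtains K where "\<And>y N. 0 \<le> y \<Longrightarrow>
    (\<Sum>m<N. 2 powr (real m - 2 * real m / p) *
       (\<Sum>i\<le>m. 2 powr ((2 - p) / 2 * (real m - real i)) * (min y (2 powr (m / p + real i - real m)))\<^sup>2))
    \<le> K * y powr p"
proof -
  define \<theta> where "\<theta> = 2 / p - 1"
  have "0 < \<theta>" using p by (simp add: \<theta>_def field_simps)
  define c where "c = 2 + 1 / (1 - 2 powr - \<theta>)"
  have "2 powr - \<theta> < 1" using \<open>0 < \<theta>\<close> by (simp add: powr_less_one)
  then have "0 \<le> c" by (simp add: c_def)
  define r where "r = 2 powr (- (2 - p) / 2)"
  have r: "0 \<le> r" "r < 1" using p by (auto simp: r_def powr_less_one)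
  define f where "f y m l = 2 powr (real m - 2 * real m / p) *
     (2 powr ((2 - p) / 2 * l) * (min y (2 powr (m / p - l)))\<^sup>2)" for y :: real and m l :: nat
  have f_le: "(\<Sum>m<N. f y m l) \<le> c * y powr p * r ^ l" if "0 < y" for y and l N :: nat
  proof -
    define w where "w = (y * 2 ^ l) powr p"
    have "0 < w" using that by (simp add: w_def)
    have w: "w = y powr p * 2 powr (p * l)"
      using that by (simp add: w_def powr_mult powr_realpow[symmetric] powr_powr mult.commute)
    have "f y m l \<le> 2 powr ((2 - p) / 2 * l - 2 * l) * min (2 ^ m) (w * (w / 2 ^ m) powr \<theta>)" for m
    proof -
      have "f y m l \<le> 2 powr (real m - 2 * real m / p) * (2 powr ((2 - p) / 2 * l) * (2 powr (m / p - l))\<^sup>2)"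
        unfolding f_def using that by (intro mult_left_mono power_mono) auto
      also have "\<dots> = 2 powr ((2 - p) / 2 * l - 2 * l) * 2 ^ m"
        by (simp add: two_power_eq_powr two_powr_power flip: powr_add) (simp add: algebra_simps)
      finally have 1: "f y m l \<le> 2 powr ((2 - p) / 2 * l - 2 * l) * 2 ^ m" .
      have "f y m l \<le> 2 powr (real m - 2 * real m / p) * (2 powr ((2 - p) / 2 * l) * y\<^sup>2)"
        unfolding f_def using that by (intro mult_left_mono power_mono) auto
      also have "\<dots> = 2 powr ((2 - p) / 2 * l - 2 * l) * (w * (w / 2 ^ m) powr \<theta>)"
      proof -
        have "w * (w / 2 ^ m) powr \<theta> = w powr (1 + \<theta>) * 2 powr (- \<theta> * m)"
          using \<open>0 < w\<close> by (simp add: powr_divide powr_add powr_minus_divide two_power_eq_powr powr_powr mult.commute)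
        also have "w powr (1 + \<theta>) = y\<^sup>2 * 2 powr (2 * real l)"
          using that p unfolding w \<theta>_def by (simp add: powr_mult powr_powr powr_numeral mult.commute)
        also have "y\<^sup>2 * 2 powr (2 * real l) * 2 powr (- \<theta> * m) = y\<^sup>2 * 2 powr (2 * real l + (real m - 2 * real m / p))"
          by (simp add: mult.assoc flip: powr_add) (simp add: \<theta>_def algebra_simps)
        finally have "w * (w / 2 ^ m) powr \<theta> = y\<^sup>2 * 2 powr (2 * real l + (real m - 2 * real m / p))" .
        then show ?thesis
          by (simp add: ac_simps flip: powr_add) (simp add: algebra_simps)
      qed
      finally have 2: "f y m l \<le> 2 powr ((2 - p) / 2 * l - 2 * l) * (w * (w / 2 ^ m) powr \<theta>)" .
      show ?thesis using 1 2 by (simp add: min_def)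
    qed
    then have "(\<Sum>m<N. f y m l)
        \<le> 2 powr ((2 - p) / 2 * l - 2 * l) * (\<Sum>m<N. min (2 ^ m) (w * (w / 2 ^ m) powr \<theta>))"
      unfolding sum_distrib_left by (intro sum_mono)
    also have "\<dots> \<le> 2 powr ((2 - p) / 2 * l - 2 * l) * (c * w)"
      unfolding c_def using \<open>0 < w\<close> \<open>0 < \<theta>\<close> by (intro mult_left_mono sum_min_dyadic_le) auto
    also have "\<dots> = c * y powr p * r ^ l"
    proof -
      have "2 powr ((2 - p) / 2 * l - 2 * l) * 2 powr (p * l) = r ^ l"
        by (simp add: r_def two_powr_power flip: powr_add) (simp add: field_simps)
      then show ?thesis by (simp add: w ac_simps)
    qed
    finally show ?thesis .
  qed
  show ?thesis
  proof (rule that)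
    fix y :: real and N
    assume "0 \<le> y"
    let ?S = "\<Sum>m<N. 2 powr (real m - 2 * real m / p) *
       (\<Sum>i\<le>m. 2 powr ((2 - p) / 2 * (real m - real i)) * (min y (2 powr (m / p + real i - real m)))\<^sup>2)"
    show "?S \<le> c / (1 - r) * y powr p"
    proof (cases "y = 0")
      case True
      then show ?thesis by simp
    next
      case False
      have "?S = (\<Sum>m<N. \<Sum>l\<le>m. f y m l)"
      proof (intro sum.cong refl)
        fix m
        have "(\<Sum>i\<le>m. 2 powr ((2 - p) / 2 * (real m - real i)) * (min y (2 powr (m / p + real i - real m)))\<^sup>2)
          = (\<Sum>l\<le>m. 2 powr ((2 - p) / 2 * real l) * (min y (2 powr (m / p - real l)))\<^sup>2)"
          by (rule sum.reindex_bij_witness[where i="\<lambda>l. m - l" and j="\<lambda>i. m - i"])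
             (auto simp: of_nat_diff algebra_simps)
        then show "2 powr (real m - 2 * real m / p) *
          (\<Sum>i\<le>m. 2 powr ((2 - p) / 2 * (real m - real i)) * (min y (2 powr (m / p + real i - real m)))\<^sup>2)
          = (\<Sum>l\<le>m. f y m l)"
          by (simp add: f_def sum_distrib_left)
      qed
      also have "\<dots> \<le> (\<Sum>m<N. \<Sum>l<N. f y m l)"
        by (intro sum_mono sum_mono2) (auto simp: f_def)
      also have "\<dots> = (\<Sum>l<N. \<Sum>m<N. f y m l)" by (rule sum.swap)
      also have "\<dots> \<le> (\<Sum>l<N. c * y powr p * r ^ l)"
        using False \<open>0 \<le> y\<close> by (intro sum_mono f_le) auto
      also have "\<dots> \<le> c * y powr p * (1 / (1 - r))"
        unfolding sum_distrib_left[symmetric]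
        using sum_geometric_le[OF r] \<open>0 \<le> c\<close> by (intro mult_left_mono) auto
      finally show ?thesis by simp
    qed
  qed
qed

section \<open>Moments of truncated nonnegative variables\<close>

text \<open>The situation after the reduction to nonnegative variables. Of the dependence only the sign of the
covariances of truncations at a common level is kept, which positive and negative parts share.\<close>

locale dominated_truncation_nqd = prob_space +
  fixes Z :: "nat \<Rightarrow> 'a \<Rightarrow> real" and Y :: "'a \<Rightarrow> real" and C p :: real
  assumes Z_measurable [measurable]: "\<And>k. Z k \<in> borel_measurable M"
    and Y_measurable [measurable]: "Y \<in> borel_measurable M"
    and Z_nonneg: "\<And>k \<omega>. 0 \<le> Z k \<omega>" and Y_nonneg: "\<And>\<omega>. 0 \<le> Y \<omega>"
    and C_nonneg: "0 \<le> C"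
    and tail: "\<And>k t. 0 < t \<Longrightarrow> \<P>(\<omega> in M. t < Z k \<omega>) \<le> C * \<P>(\<omega> in M. t < Y \<omega>)"
    and truncation_covariance: "\<And>j k t. j \<noteq> k \<Longrightarrow> 0 < t \<Longrightarrow>
      expectation (\<lambda>\<omega>. min (Z j \<omega>) t * min (Z k \<omega>) t)
        \<le> expectation (\<lambda>\<omega>. min (Z j \<omega>) t) * expectation (\<lambda>\<omega>. min (Z k \<omega>) t)"
    and p: "1 < p" "p < 2"
    and Y_moment: "integrable M (\<lambda>\<omega>. Y \<omega> powr p)"
begin

lemma integrable_Y: "integrable M Y"
proof (rule Bochner_Integration.integrable_bound)
  show "integrable M (\<lambda>\<omega>. 1 + Y \<omega> powr p)" using Y_moment by simp
  have "y \<le> 1 + y powr p" if "0 \<le> y" for y :: real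
  proof (cases "y \<le> 1")
    case False
    then have "y powr 1 \<le> y powr p" using p by (intro powr_mono) auto
    then show ?thesis using False by simp
  qed (simp add: add_increasing2)
  then show "AE \<omega> in M. norm (Y \<omega>) \<le> norm (1 + Y \<omega> powr p)"
    using Y_nonneg by simp
qed measurable

lemma integrable_Z: "integrable M (Z k)"
  using expectation_le_of_tail_le(1)[of "Z k" Y C "\<lambda>x. x"] Z_nonneg Y_nonneg C_nonneg tail integrable_Y
  by (simp add: continuous_on_id mono_def)

definition tail_moment :: "real \<Rightarrow> real" where
  "tail_moment t = expectation (\<lambda>\<omega>. Y \<omega> powr p * indicator {t<..} (Y \<omega>))"

lemma integrable_tail_moment: "integrable M (\<lambda>\<omega>. Y \<omega> powr p * indicator {t<..} (Y \<omega>))"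
  using Y_moment by (rule Bochner_Integration.integrable_bound) (auto simp: indicator_def)

lemma tail_moment_nonneg: "0 \<le> tail_moment t"
  unfolding tail_moment_def by (intro integral_nonneg_AE) auto

lemma tail_moment_le: "tail_moment t \<le> expectation (\<lambda>\<omega>. Y \<omega> powr p)"
  unfolding tail_moment_def
  by (intro integral_mono integrable_tail_moment Y_moment) (auto simp: indicator_def)

lemma tail_moment_tendsto_0: "(tail_moment \<longlongrightarrow> 0) at_top"
proof -
  have "((\<lambda>t. expectation (\<lambda>\<omega>. Y \<omega> powr p * indicator {t<..} (Y \<omega>))) \<longlongrightarrow> expectation (\<lambda>\<omega>. 0)) at_top"
  proof (rule integral_dominated_convergence_at_top[where w="\<lambda>\<omega>. Y \<omega> powr p"])
    show "AE \<omega> in M. ((\<lambda>t. Y \<omega> powr p * indicator {t<..} (Y \<omega>)) \<longlongrightarrow> 0) at_top"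
    proof (rule AE_I2)
      fix \<omega>
      have "eventually (\<lambda>t. Y \<omega> powr p * indicator {t<..} (Y \<omega>) = 0) at_top"
        using eventually_ge_at_top[of "Y \<omega>"] by eventually_elim auto
      then show "((\<lambda>t. Y \<omega> powr p * indicator {t<..} (Y \<omega>)) \<longlongrightarrow> 0) at_top"
        by (rule tendsto_eventually)
    qed
    show "eventually (\<lambda>t. AE \<omega> in M. norm (Y \<omega> powr p * indicator {t<..} (Y \<omega>)) \<le> Y \<omega> powr p) at_top"
      by (intro always_eventually allI AE_I2) (auto simp: indicator_def)
  qed (use Y_moment in auto)
  then show ?thesis by (simp add: tail_moment_def[abs_def])
qed

text \<open>On the event \<open>t < Y\<close> one has \<open>Y = Y powr (1 - p) * Y powr p \<le> t powr (1 - p) * Y powr p\<close>, because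
\<open>1 - p\<close> is negative.\<close>

lemma expectation_excess_le:
  assumes "0 < t"
  shows "expectation (\<lambda>\<omega>. Z k \<omega> - min (Z k \<omega>) t) \<le> C * t powr (1 - p) * tail_moment t"
proof -
  define h where "h x = x - min x t" for x
  have h: "continuous_on UNIV h" "mono h" "h 0 = 0"
    using assms unfolding h_def by (auto intro!: continuous_intros monoI)
  have hY: "h (Y \<omega>) \<le> t powr (1 - p) * (Y \<omega> powr p * indicator {t<..} (Y \<omega>))" for \<omega>
  proof (cases "t < Y \<omega>")
    case True
    have "Y \<omega> = Y \<omega> powr (1 - p) * Y \<omega> powr p"
      using True assms by (simp add: powr_add[symmetric])
    also have "\<dots> \<le> t powr (1 - p) * Y \<omega> powr p"
      using True assms p by (intro mult_right_mono powr_mono2') auto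
    finally show ?thesis using True assms by (simp add: h_def)
  qed (simp add: h_def)
  have intY: "integrable M (\<lambda>\<omega>. h (Y \<omega>))"
    unfolding h_def using integrable_Y assms Y_nonneg
    by (intro Bochner_Integration.integrable_diff integrable_Y integrable_const_bound[where B=t]) auto
  have "expectation (\<lambda>\<omega>. h (Z k \<omega>)) \<le> C * expectation (\<lambda>\<omega>. h (Y \<omega>))"
    by (rule expectation_le_of_tail_le(2)[OF _ _ Z_nonneg Y_nonneg C_nonneg tail h intY]) auto
  also have "\<dots> \<le> C * expectation (\<lambda>\<omega>. t powr (1 - p) * (Y \<omega> powr p * indicator {t<..} (Y \<omega>)))"
    by (intro mult_left_mono integral_mono intY hY C_nonneg integrable_mult_right integrable_tail_moment)
  finally show ?thesis by (simp add: h_def tail_moment_def mult.assoc)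
qed

lemma expectation_truncation_sq_le:
  assumes "0 < t"
  shows "expectation (\<lambda>\<omega>. (min (Z k \<omega>) t)\<^sup>2) \<le> C * expectation (\<lambda>\<omega>. (min (Y \<omega>) t)\<^sup>2)"
proof -
  \<comment> \<open>the extra maximum makes the square monotone on the whole line\<close>
  define h where "h x = (max 0 (min x t))\<^sup>2" for x
  have h: "continuous_on UNIV h" "mono h" "h 0 = 0"
    using assms unfolding h_def by (auto intro!: continuous_intros monoI power_mono)
  have intY: "integrable M (\<lambda>\<omega>. h (Y \<omega>))"
    unfolding h_def using assms
    by (intro integrable_const_bound[where B="t\<^sup>2"]) (auto intro!: AE_I2 power_mono)
  have "expectation (\<lambda>\<omega>. h (Z k \<omega>)) \<le> C * expectation (\<lambda>\<omega>. h (Y \<omega>))"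
    by (rule expectation_le_of_tail_le(2)[OF _ _ Z_nonneg Y_nonneg C_nonneg tail h intY]) auto
  then show ?thesis using assms Z_nonneg Y_nonneg by (simp add: h_def max_absorb2)
qed

definition centred :: "real \<Rightarrow> nat \<Rightarrow> 'a \<Rightarrow> real" where
  "centred t k \<omega> = min (Z k \<omega>) t - expectation (\<lambda>\<omega>. min (Z k \<omega>) t)"

lemma integrable_truncation: "0 < t \<Longrightarrow> integrable M (\<lambda>\<omega>. min (Z k \<omega>) t)"
  using Z_nonneg by (intro integrable_const_bound[where B=t]) auto

lemma integrable_truncation_mult: "0 < t \<Longrightarrow> integrable M (\<lambda>\<omega>. min (Z j \<omega>) t * min (Z k \<omega>) t)"
  using Z_nonneg by (intro integrable_const_bound[where B="t * t"]) (auto intro!: AE_I2 mult_mono simp: abs_mult)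

lemma centred_product:
  assumes "0 < t"
  shows "integrable M (\<lambda>\<omega>. centred t j \<omega> * centred t k \<omega>)"
    and "expectation (\<lambda>\<omega>. centred t j \<omega> * centred t k \<omega>)
      = expectation (\<lambda>\<omega>. min (Z j \<omega>) t * min (Z k \<omega>) t)
        - expectation (\<lambda>\<omega>. min (Z j \<omega>) t) * expectation (\<lambda>\<omega>. min (Z k \<omega>) t)"
  unfolding centred_def left_diff_distrib right_diff_distrib
  using integrable_truncation[OF assms] integrable_truncation_mult[OF assms]
  by (auto simp: prob_space)

text \<open>Only the diagonal terms of the expanded square can be positive, so pairwise information gives the bound
that is known for independent variables.\<close>

lemma block_second_moment_le:
  assumes "0 < t" and "finite A"
  shows "integrable M (\<lambda>\<omega>. (\<Sum>k\<in>A. centred t k \<omega>)\<^sup>2)"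
    and "expectation (\<lambda>\<omega>. (\<Sum>k\<in>A. centred t k \<omega>)\<^sup>2) \<le> card A * (C * expectation (\<lambda>\<omega>. (min (Y \<omega>) t)\<^sup>2))"
proof -
  have eq: "(\<Sum>k\<in>A. centred t k \<omega>)\<^sup>2 = (\<Sum>j\<in>A. \<Sum>k\<in>A. centred t j \<omega> * centred t k \<omega>)" for \<omega>
    by (simp add: power2_eq_square sum_product)
  show "integrable M (\<lambda>\<omega>. (\<Sum>k\<in>A. centred t k \<omega>)\<^sup>2)"
    unfolding eq by (intro Bochner_Integration.integrable_sum centred_product assms)
  have "expectation (\<lambda>\<omega>. (\<Sum>k\<in>A. centred t k \<omega>)\<^sup>2)
      = (\<Sum>j\<in>A. \<Sum>k\<in>A. expectation (\<lambda>\<omega>. centred t j \<omega> * centred t k \<omega>))"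
    unfolding eq by (simp add: centred_product assms)
  also have "\<dots> \<le> (\<Sum>j\<in>A. \<Sum>k\<in>A. if k = j then C * expectation (\<lambda>\<omega>. (min (Y \<omega>) t)\<^sup>2) else 0)"
  proof (intro sum_mono)
    fix j k
    show "expectation (\<lambda>\<omega>. centred t j \<omega> * centred t k \<omega>)
        \<le> (if k = j then C * expectation (\<lambda>\<omega>. (min (Y \<omega>) t)\<^sup>2) else 0)"
    \<comment> \<open>a diagonal term is a variance, hence at most the second moment\<close>
    proof (cases "k = j")
      case True
      have "expectation (\<lambda>\<omega>. centred t j \<omega> * centred t j \<omega>) \<le> expectation (\<lambda>\<omega>. (min (Z j \<omega>) t)\<^sup>2)"
        by (simp add: centred_product assms power2_eq_square)
      also have "\<dots> \<le> C * expectation (\<lambda>\<omega>. (min (Y \<omega>) t)\<^sup>2)"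
        by (rule expectation_truncation_sq_le[OF assms(1)])
      finally show ?thesis using True by simp
    next
      case False
      then show ?thesis
        using truncation_covariance[of j k t] assms by (simp add: centred_product)
    qed
  qed
  also have "\<dots> = card A * (C * expectation (\<lambda>\<omega>. (min (Y \<omega>) t)\<^sup>2))"
    using assms by simp
  finally show "expectation (\<lambda>\<omega>. (\<Sum>k\<in>A. centred t k \<omega>)\<^sup>2) \<le> card A * (C * expectation (\<lambda>\<omega>. (min (Y \<omega>) t)\<^sup>2))" .
qed

text \<open>Borel-Cantelli, with \<open>P (Z n > (n + 1) powr (1 / p)) \<le> C * P (Y powr p > n + 1)\<close>; the latter
probabilities are summable because at most \<open>y\<close> of the numbers \<open>1, 2, ...\<close> lie below \<open>y\<close>.\<close>

lemma AE_eventually_Z_le: "AE \<omega> in M. eventually (\<lambda>n. Z n \<omega> \<le> real (Suc n) powr (1 / p)) sequentially"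
proof -
  define A where "A n = {\<omega> \<in> space M. real (Suc n) powr (1 / p) < Z n \<omega>}" for n
  have [measurable]: "A n \<in> sets M" for n unfolding A_def by measurable
  have le: "real (Suc n) powr (1 / p) < y \<longleftrightarrow> real (Suc n) < y powr p" if "0 \<le> y" for n y
  proof -
    have "real (Suc n) < y powr p \<longleftrightarrow> (real (Suc n) powr (1 / p)) powr p < y powr p"
      using p by (simp add: powr_powr)
    also have "\<dots> \<longleftrightarrow> real (Suc n) powr (1 / p) < y"
      using powr_less_mono2[of p "real (Suc n) powr (1 / p)" y] powr_mono2[of p y "real (Suc n) powr (1 / p)"] that p
      by (cases "real (Suc n) powr (1 / p) < y") auto
    finally show ?thesis by simp
  qed
  have bound: "(\<Sum>n<N. indicator {\<omega> \<in> space M. real (Suc n) < Y \<omega> powr p} \<omega>) \<le> Y \<omega> powr p" for N \<omega>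
  proof -
    have "(\<Sum>n<N. if real (Suc n) < y then 1 else 0) \<le> y" if "0 \<le> y" for y :: real
    proof -
      have "(\<Sum>n<N. if real (Suc n) < y then 1 else 0) = real (card {n\<in>{..<N}. real (Suc n) < y})"
        by (simp add: sum.If_cases Int_def)
      also have "card {n\<in>{..<N}. real (Suc n) < y} \<le> card {..<nat \<lfloor>y\<rfloor>}"
        by (intro card_mono) (auto simp: Suc_le_eq[symmetric] le_nat_iff le_floor_iff)
      also have "real (card {..<nat \<lfloor>y\<rfloor>}) \<le> y" using that by simp
      finally show ?thesis by simp
    qed
    from this[of "Y \<omega> powr p"] have "(\<Sum>n<N. if real (Suc n) < Y \<omega> powr p then 1 else 0) \<le> Y \<omega> powr p" by simp
    moreover have "(\<Sum>n<N. indicator {\<omega> \<in> space M. real (Suc n) < Y \<omega> powr p} \<omega>)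
       \<le> (\<Sum>n<N. if real (Suc n) < Y \<omega> powr p then 1 else 0 :: real)"
      by (intro sum_mono) (auto simp: indicator_def)
    ultimately show ?thesis by linarith
  qed
  have "summable (\<lambda>n. \<P>(\<omega> in M. real (Suc n) < Y \<omega> powr p))"
  proof (rule summableI_nonneg_bounded)
    fix N
    have "(\<Sum>n<N. \<P>(\<omega> in M. real (Suc n) < Y \<omega> powr p))
        = expectation (\<lambda>\<omega>. \<Sum>n<N. indicator {\<omega> \<in> space M. real (Suc n) < Y \<omega> powr p} \<omega>)"
      by (subst Bochner_Integration.integral_sum) (auto simp: emeasure_eq_measure)
    also have "\<dots> \<le> expectation (\<lambda>\<omega>. Y \<omega> powr p)"
      by (intro integral_mono Y_moment bound) (auto simp: emeasure_eq_measure)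
    finally show "(\<Sum>n<N. \<P>(\<omega> in M. real (Suc n) < Y \<omega> powr p)) \<le> expectation (\<lambda>\<omega>. Y \<omega> powr p)" .
  qed auto
  then have "summable (\<lambda>n. C * \<P>(\<omega> in M. real (Suc n) < Y \<omega> powr p))" by (rule summable_mult)
  moreover have "norm (measure M (A n)) \<le> C * \<P>(\<omega> in M. real (Suc n) < Y \<omega> powr p)" for n
    using tail[of "real (Suc n) powr (1 / p)" n] le[OF Y_nonneg, of n] by (simp add: A_def)
  ultimately have "summable (\<lambda>n. measure M (A n))"
    by (rule summable_comparison_test'[where N=0])
  then have "AE \<omega> in M. eventually (\<lambda>n. \<omega> \<in> space M - A n) sequentially"
    by (intro borel_cantelli_AE1) (auto simp: emeasure_eq_measure)
  then show ?thesis
    by eventually_elim (auto elim!: eventually_mono simp: A_def)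
qed

section \<open>Energy of the dyadic blocks\<close>

text \<open>The truncation level for blocks of length \<open>2 ^ i\<close> when partial sums up to \<open>2 ^ m\<close> are considered. It
equals \<open>2 powr (m / p)\<close> at the top scale \<open>i = m\<close>, and is halved whenever the block length is. This ratio is
small enough for the variances to decay geometrically in \<open>m - i\<close>, and since \<open>p < 2\<close> large enough for
the means of the discarded parts to do so as well.\<close>

definition level :: "nat \<Rightarrow> nat \<Rightarrow> real" where
  "level m i = 2 powr (m / p + real i - real m)"

lemma level_pos: "0 < level m i"
  by (simp add: level_def)

definition block_energy :: "nat \<Rightarrow> nat \<Rightarrow> 'a \<Rightarrow> real" where
  "block_energy m i \<omega> = (\<Sum>j<2 ^ (m - i). (\<Sum>k\<in>{j * 2 ^ i..<Suc j * 2 ^ i}. centred (level m i) k \<omega>)\<^sup>2)"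

text \<open>The factor \<open>2 powr (- 2 * m / p)\<close> is the square of the norming. The weights, growing geometrically in
\<open>m - i\<close>, allow the maxima over the scales to be added up by the Cauchy-Schwarz inequality.\<close>

definition weighted_energy :: "nat \<Rightarrow> 'a \<Rightarrow> real" where
  "weighted_energy m \<omega> =
     2 powr (- 2 * real m / p) * (\<Sum>i\<le>m. 2 powr ((2 - p) / 2 * (real m - real i)) * block_energy m i \<omega>)"

lemma block_energy_nonneg: "0 \<le> block_energy m i \<omega>"
  unfolding block_energy_def by (intro sum_nonneg) auto

lemma weighted_energy_nonneg: "0 \<le> weighted_energy m \<omega>"
  unfolding weighted_energy_def by (intro mult_nonneg_nonneg sum_nonneg block_energy_nonneg) auto

lemma expectation_block_energy_le:
  assumes "i \<le> m"
  shows "integrable M (block_energy m i)"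
    and "expectation (block_energy m i) \<le> 2 ^ m * (C * expectation (\<lambda>\<omega>. (min (Y \<omega>) (level m i))\<^sup>2))"
proof -
  note sm = block_second_moment_le[OF level_pos[of m i], of "{j * 2 ^ i..<Suc j * 2 ^ i}" for j]
  show "integrable M (block_energy m i)"
    unfolding block_energy_def by (intro Bochner_Integration.integrable_sum sm) simp
  have "expectation (block_energy m i)
     = (\<Sum>j<2 ^ (m - i). expectation (\<lambda>\<omega>. (\<Sum>k\<in>{j * 2 ^ i..<Suc j * 2 ^ i}. centred (level m i) k \<omega>)\<^sup>2))"
    unfolding block_energy_def by (intro Bochner_Integration.integral_sum sm) simp
  also have "\<dots> \<le> (\<Sum>j<2 ^ (m - i). real (card {j * 2 ^ i..<Suc j * 2 ^ i}) *
      (C * expectation (\<lambda>\<omega>. (min (Y \<omega>) (level m i))\<^sup>2)))"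
    by (intro sum_mono sm) simp
  also have "\<dots> = (2 ^ (m - i) * 2 ^ i) * (C * expectation (\<lambda>\<omega>. (min (Y \<omega>) (level m i))\<^sup>2))"
    by simp
  also have "(2::real) ^ (m - i) * 2 ^ i = 2 ^ m"
    using assms by (simp flip: power_add)
  finally show "expectation (block_energy m i) \<le> 2 ^ m * (C * expectation (\<lambda>\<omega>. (min (Y \<omega>) (level m i))\<^sup>2))" .
qed

lemma integrable_weighted_energy: "integrable M (weighted_energy m)"
  unfolding weighted_energy_def[abs_def]
  by (intro integrable_mult_right Bochner_Integration.integrable_sum expectation_block_energy_le) simp

lemma integrable_truncated_sq: "0 < t \<Longrightarrow> integrable M (\<lambda>\<omega>. (min (Y \<omega>) t)\<^sup>2)"
  using Y_nonneg by (intro integrable_const_bound[where B="t\<^sup>2"]) (auto intro!: AE_I2 power_mono)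

text \<open>Each expectation is at most \<open>C\<close> times that of the function of \<open>Y\<close> in
\<open>sum_dyadic_truncated_squares_le\<close>, so the partial sums are bounded by a multiple of the
\<open>p\<close>-th moment of \<open>Y\<close>.\<close>

lemma summable_expectation_weighted_energy: "summable (\<lambda>m. expectation (weighted_energy m))"
proof -
  obtain K where K: "\<And>y N. 0 \<le> y \<Longrightarrow>
    (\<Sum>m<N. 2 powr (real m - 2 * real m / p) *
       (\<Sum>i\<le>m. 2 powr ((2 - p) / 2 * (real m - real i)) * (min y (level m i))\<^sup>2))
    \<le> K * y powr p"
    using sum_dyadic_truncated_squares_le[OF p] unfolding level_def by blast
  define g where "g m \<omega> = 2 powr (real m - 2 * real m / p) *
       (\<Sum>i\<le>m. 2 powr ((2 - p) / 2 * (real m - real i)) * (min (Y \<omega>) (level m i))\<^sup>2)" for m \<omega>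
  have int_g: "integrable M (g m)" for m
    unfolding g_def
    by (intro integrable_mult_right Bochner_Integration.integrable_sum integrable_truncated_sq level_pos)
  have le: "expectation (weighted_energy m) \<le> C * expectation (g m)" for m
  proof -
    have "expectation (weighted_energy m) = 2 powr (- 2 * real m / p) *
        (\<Sum>i\<le>m. 2 powr ((2 - p) / 2 * (real m - real i)) * expectation (block_energy m i))"
      unfolding weighted_energy_def[abs_def] by (simp add: expectation_block_energy_le)
    also have "\<dots> \<le> 2 powr (- 2 * real m / p) * (\<Sum>i\<le>m. 2 powr ((2 - p) / 2 * (real m - real i)) *
        (2 ^ m * (C * expectation (\<lambda>\<omega>. (min (Y \<omega>) (level m i))\<^sup>2))))"
      by (intro mult_left_mono sum_mono expectation_block_energy_le) auto
    also have "\<dots> = C * ((2 powr (- 2 * real m / p) * 2 ^ m) *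
        (\<Sum>i\<le>m. 2 powr ((2 - p) / 2 * (real m - real i)) * expectation (\<lambda>\<omega>. (min (Y \<omega>) (level m i))\<^sup>2)))"
      by (simp add: sum_distrib_left ac_simps)
    also have "2 powr (- 2 * real m / p) * 2 ^ m = 2 powr (real m - 2 * real m / p)"
      by (simp add: two_power_eq_powr flip: powr_add)
    also have "2 powr (real m - 2 * real m / p) * (\<Sum>i\<le>m. 2 powr ((2 - p) / 2 * (real m - real i)) *
        expectation (\<lambda>\<omega>. (min (Y \<omega>) (level m i))\<^sup>2)) = expectation (g m)"
      unfolding g_def by (simp add: integrable_truncated_sq level_pos)
    finally show ?thesis .
  qed
  show ?thesis
  proof (rule summableI_nonneg_bounded)
    fix N
    have "(\<Sum>m<N. expectation (weighted_energy m)) \<le> (\<Sum>m<N. C * expectation (g m))"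
      by (intro sum_mono le)
    also have "\<dots> = C * expectation (\<lambda>\<omega>. \<Sum>m<N. g m \<omega>)"
      by (simp add: int_g sum_distrib_left)
    also have "\<dots> \<le> C * expectation (\<lambda>\<omega>. K * Y \<omega> powr p)"
      using K[OF Y_nonneg] unfolding g_def[symmetric]
      by (intro mult_left_mono integral_mono Bochner_Integration.integrable_sum int_g
            integrable_mult_right Y_moment C_nonneg)
    finally show "(\<Sum>m<N. expectation (weighted_energy m)) \<le> C * expectation (\<lambda>\<omega>. K * Y \<omega> powr p)" .
  qed (intro integral_nonneg_AE AE_I2 weighted_energy_nonneg)
qed

lemma AE_weighted_energy_tendsto_0: "AE \<omega> in M. (\<lambda>m. weighted_energy m \<omega>) \<longlonglongrightarrow> 0"
proof -
  have [measurable]: "weighted_energy m \<in> borel_measurable M" for m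
    using integrable_weighted_energy by auto
  have "(\<integral>\<^sup>+\<omega>. (\<Sum>m. ennreal (weighted_energy m \<omega>)) \<partial>M) = (\<Sum>m. \<integral>\<^sup>+\<omega>. ennreal (weighted_energy m \<omega>) \<partial>M)"
    by (rule nn_integral_suminf) measurable
  also have "\<dots> = (\<Sum>m. ennreal (expectation (weighted_energy m)))"
    by (simp add: nn_integral_eq_integral integrable_weighted_energy weighted_energy_nonneg)
  also have "\<dots> = ennreal (\<Sum>m. expectation (weighted_energy m))"
    by (intro suminf_ennreal2 summable_expectation_weighted_energy integral_nonneg_AE AE_I2 weighted_energy_nonneg)
  finally have "(\<integral>\<^sup>+\<omega>. (\<Sum>m. ennreal (weighted_energy m \<omega>)) \<partial>M) \<noteq> \<infinity>" by simp
  then have "AE \<omega> in M. (\<Sum>m. ennreal (weighted_energy m \<omega>)) \<noteq> \<infinity>"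
    by (intro nn_integral_PInf_AE) measurable
  then show ?thesis
  proof eventually_elim
    case (elim \<omega>)
    then have "summable (\<lambda>m. weighted_energy m \<omega>)"
      by (intro summable_suminf_not_top weighted_energy_nonneg) auto
    then show ?case by (rule summable_LIMSEQ_zero)
  qed
qed

text \<open>Up to the factor \<open>2 * C * 2 powr (m / p)\<close>, the total mean that the truncations discard along the
chaining (see \<open>level_excess_le\<close> below).\<close>

definition bias :: "nat \<Rightarrow> real" where
  "bias m = (\<Sum>l\<le>m. (2 powr (- (2 - p))) ^ l * tail_moment (2 powr (m / p - l)))"

text \<open>Every summand tends to \<open>0\<close>, since for fixed \<open>l\<close> the threshold tends to infinity; the geometric weights
dominate, so that Tannery's theorem applies.\<close>

lemma bias_tendsto_0: "bias \<longlonglongrightarrow> 0"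
proof -
  define r where "r = 2 powr (- (2 - p))"
  have r: "0 \<le> r" "r < 1" using p by (auto simp: r_def powr_less_one)
  define a where "a l m = (if l \<le> m then r ^ l * tail_moment (2 powr (m / p - l)) else 0)" for l m :: nat
  have "(\<lambda>m. \<Sum>l. a l m) \<longlonglongrightarrow> (\<Sum>l. 0)"
  proof (rule conjunct2[OF conjunct2[OF tannerys_theorem[where M="\<lambda>l. r ^ l * expectation (\<lambda>\<omega>. Y \<omega> powr p)"]]])
    fix l :: nat
    have "filterlim (\<lambda>m. 2 powr (real m / p - l)) at_top sequentially"
      using p by real_asymp
    then have "(\<lambda>m. tail_moment (2 powr (real m / p - l))) \<longlonglongrightarrow> 0"
      by (rule filterlim_compose[OF tail_moment_tendsto_0])
    then have "(\<lambda>m. r ^ l * tail_moment (2 powr (real m / p - l))) \<longlonglongrightarrow> 0"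
      by (rule tendsto_mult_right_zero)
    moreover have "eventually (\<lambda>m. r ^ l * tail_moment (2 powr (real m / p - l)) = a l m) sequentially"
      using eventually_ge_at_top[of l] by eventually_elim (simp add: a_def)
    ultimately show "(\<lambda>m. a l m) \<longlonglongrightarrow> 0" by (rule Lim_transform_eventually)
  next
    show "\<forall>\<^sub>F (l, m) in at_top \<times>\<^sub>F sequentially. norm (a l m) \<le> r ^ l * expectation (\<lambda>\<omega>. Y \<omega> powr p)"
    proof (intro always_eventually allI, clarify)
      fix l m :: nat
      have "0 \<le> expectation (\<lambda>\<omega>. Y \<omega> powr p)" using tail_moment_nonneg tail_moment_le order_trans by blast
      then show "norm (a l m) \<le> r ^ l * expectation (\<lambda>\<omega>. Y \<omega> powr p)"
        using r tail_moment_nonneg tail_moment_le by (auto simp: a_def abs_mult intro!: mult_left_mono)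
    qed
    show "summable (\<lambda>l. r ^ l * expectation (\<lambda>\<omega>. Y \<omega> powr p))"
      using r by (intro summable_mult2 summable_geometric) simp
  qed simp
  moreover have "(\<Sum>l. a l m) = bias m" for m
    by (subst suminf_finite[of "{..m}"]) (auto simp: a_def bias_def r_def)
  ultimately show ?thesis by simp
qed

lemma sum_sqrt_block_energy_le:
  "(\<Sum>i\<le>m. sqrt (block_energy m i \<omega>))
     \<le> 2 powr (m / p) * sqrt (weighted_energy m \<omega> / (1 - 2 powr (- (2 - p) / 2)))"
proof -
  define r where "r = 2 powr (- (2 - p) / 2)"
  have r: "0 \<le> r" "r < 1" using p by (auto simp: r_def powr_less_one)
  define w where "w i = 2 powr ((2 - p) / 2 * (real m - real i))" for i
  have w: "0 < w i" for i by (simp add: w_def)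
  have inv: "(\<Sum>i\<le>m. 1 / w i) \<le> 1 / (1 - r)"
  proof -
    have "1 / w i = r ^ (m - i)" if "i \<le> m" for i
      using that unfolding w_def r_def two_powr_power powr_minus_divide[symmetric]
      by (intro arg_cong[where f="(powr) 2"]) (simp add: of_nat_diff field_simps)
    then have "(\<Sum>i\<le>m. 1 / w i) = (\<Sum>l<Suc m. r ^ l)"
      by (intro sum.reindex_bij_witness[where i="\<lambda>l. m - l" and j="\<lambda>i. m - i"]) auto
    then show ?thesis using sum_geometric_le[OF r, of "Suc m"] by simp
  qed
  \<comment> \<open>Cauchy-Schwarz: the reciprocal weights form a geometric series\<close>
  have "(\<Sum>i\<le>m. sqrt (block_energy m i \<omega>))\<^sup>2
      = (\<Sum>i\<le>m. sqrt (1 / w i) * sqrt (w i * block_energy m i \<omega>))\<^sup>2"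
    using w by (simp add: real_sqrt_mult[symmetric] less_imp_neq[OF w, symmetric])
  also have "\<dots> \<le> (\<Sum>i\<le>m. (sqrt (1 / w i))\<^sup>2) * (\<Sum>i\<le>m. (sqrt (w i * block_energy m i \<omega>))\<^sup>2)"
    by (rule Cauchy_Schwarz_ineq_sum)
  also have "\<dots> = (\<Sum>i\<le>m. 1 / w i) * (\<Sum>i\<le>m. w i * block_energy m i \<omega>)"
    using w block_energy_nonneg by (simp add: less_imp_le)
  also have "\<dots> \<le> 1 / (1 - r) * (\<Sum>i\<le>m. w i * block_energy m i \<omega>)"
    using inv w block_energy_nonneg by (intro mult_right_mono sum_nonneg) (auto simp: less_imp_le)
  also have "(\<Sum>i\<le>m. w i * block_energy m i \<omega>) = (2 powr (m / p))\<^sup>2 * weighted_energy m \<omega>"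
    by (simp add: weighted_energy_def w_def two_powr_power flip: powr_add mult.assoc)
  finally have "(\<Sum>i\<le>m. sqrt (block_energy m i \<omega>))\<^sup>2
      \<le> (2 powr (m / p) * sqrt (weighted_energy m \<omega> / (1 - r)))\<^sup>2"
    using r weighted_energy_nonneg by (simp add: power_mult_distrib)
  then show ?thesis
    unfolding r_def by (rule power2_le_imp_le) (use r weighted_energy_nonneg in \<open>simp add: r_def\<close>)
qed

text \<open>The exponents balance as \<open>i + (1 - p) * (m / p - (m - i)) = m / p - (2 - p) * (m - i)\<close>: a block of length
\<open>2 ^ i\<close> loses a mean that decays geometrically with its depth \<open>m - i\<close>.\<close>

lemma level_excess_le:
  assumes "i \<le> m"
  shows "2 ^ i * expectation (\<lambda>\<omega>. Z k \<omega> - min (Z k \<omega>) (level m i))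
     \<le> C * 2 powr (m / p) * ((2 powr (- (2 - p))) ^ (m - i) * tail_moment (level m i))"
proof -
  have "2 ^ i * expectation (\<lambda>\<omega>. Z k \<omega> - min (Z k \<omega>) (level m i))
      \<le> 2 ^ i * (C * level m i powr (1 - p) * tail_moment (level m i))"
    by (intro mult_left_mono expectation_excess_le level_pos) simp
  also have "\<dots> = C * (2 ^ i * level m i powr (1 - p)) * tail_moment (level m i)"
    by simp
  also have "2 ^ i * level m i powr (1 - p) = 2 powr (m / p) * (2 powr (- (2 - p))) ^ (m - i)"
    using assms p
    by (simp add: level_def two_power_eq_powr two_powr_power powr_powr of_nat_diff flip: powr_add)
       (simp add: field_simps)
  finally show ?thesis by (simp add: mult.assoc)
qed

section \<open>The strong law for nonnegative variables\<close>

lemma level_mono: "i \<le> i' \<Longrightarrow> level m i \<le> level m i'"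
  unfolding level_def by (intro powr_mono) auto

lemma sum_level_excess:
  "(\<Sum>i\<le>m. (2 powr (- (2 - p))) ^ (m - i) * tail_moment (level m i)) = bias m"
  unfolding bias_def
  by (rule sum.reindex_bij_witness[where i="\<lambda>l. m - l" and j="\<lambda>i. m - i"])
     (auto simp: level_def of_nat_diff algebra_simps)

text \<open>Dyadic chaining, with each block sum bounded by the root of the total energy of its scale.\<close>

lemma truncated_partial_sum_le:
  assumes "n \<le> 2 ^ m"
  shows "\<bar>\<Sum>k<n. centred (level m m) k \<omega>\<bar>
    \<le> 4 * (\<Sum>i\<le>m. sqrt (block_energy m i \<omega>))
      + 2 * C * 2 powr (m / p) * (\<Sum>i<m. (2 powr (- (2 - p))) ^ (m - i) * tail_moment (level m i))"
proof -
  define e where "e i k = expectation (\<lambda>\<omega>. min (Z k \<omega>) (level m (Suc i)))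
      - expectation (\<lambda>\<omega>. min (Z k \<omega>) (level m i))" for i k
  define G where "G i = sqrt (block_energy m i \<omega>)" for i
  define B where "B i = 2 * (C * 2 powr (m / p) * ((2 powr (- (2 - p))) ^ (m - i) * tail_moment (level m i)))" for i
  have "\<bar>\<Sum>k\<in>{0 * 2 ^ m..<n}. centred (level m m) k \<omega>\<bar> \<le> G 0 + (\<Sum>i<m. G (Suc i) + 3 * G i + B i)"
  proof (rule dyadic_chaining[where m=m and N="2 ^ m" and d="\<lambda>i. (\<lambda>k. centred (level m i) k \<omega>)" and e=e])
    fix i k
    have "min (Z k \<omega>) (level m i) \<le> min (Z k \<omega>) (level m (Suc i))" for \<omega>
      using level_mono[of i "Suc i" m] by simp
    then show "0 \<le> e i k" "- e i k \<le> centred (level m (Suc i)) k \<omega> - centred (level m i) k \<omega>"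
      unfolding e_def centred_def
      by (auto intro!: integral_mono integrable_truncation level_pos)
  next
    fix i j :: nat
    assume "i \<le> m" and j: "Suc j * 2 ^ i \<le> 2 ^ m"
    then have "2 ^ m = 2 ^ (m - i) * (2::nat) ^ i" by (simp flip: power_add)
    with j have "Suc j * 2 ^ i \<le> 2 ^ (m - i) * 2 ^ i" by (simp only:)
    then have "j < 2 ^ (m - i)" unfolding mult_le_cancel2 by simp
    then have "(\<Sum>k\<in>{j * 2 ^ i..<Suc j * 2 ^ i}. centred (level m i) k \<omega>)\<^sup>2 \<le> block_energy m i \<omega>"
      unfolding block_energy_def
      by (intro member_le_sum[where f="\<lambda>j. (\<Sum>k\<in>{j * 2 ^ i..<Suc j * 2 ^ i}. centred (level m i) k \<omega>)\<^sup>2"]) auto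
    then show "\<bar>\<Sum>k\<in>{j * 2 ^ i..<Suc j * 2 ^ i}. centred (level m i) k \<omega>\<bar> \<le> G i"
      unfolding G_def by (rule real_le_rsqrt[OF order_trans[rotated]]) simp
  next
    fix i j :: nat
    assume "i < m"
    \<comment> \<open>a block of scale \<open>i + 1\<close> has twice the length of one of scale \<open>i\<close>, whence the factor 2 in B\<close>
    have e_le: "2 ^ Suc i * e i k \<le> B i" for k
    proof -
      have "e i k \<le> expectation (\<lambda>\<omega>. Z k \<omega> - min (Z k \<omega>) (level m i))"
        unfolding e_def
        by (subst Bochner_Integration.integral_diff)
           (auto intro!: integral_mono integrable_truncation integrable_Z level_pos)
      then have "2 ^ Suc i * e i k \<le> 2 * (2 ^ i * expectation (\<lambda>\<omega>. Z k \<omega> - min (Z k \<omega>) (level m i)))"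
        by simp
      also have "\<dots> \<le> B i"
        unfolding B_def using level_excess_le[of i m k] \<open>i < m\<close> by simp
      finally show ?thesis .
    qed
    have "(\<Sum>k\<in>{j * 2 ^ Suc i..<Suc j * 2 ^ Suc i}. e i k) \<le> (\<Sum>k\<in>{j * 2 ^ Suc i..<Suc j * 2 ^ Suc i}. B i / 2 ^ Suc i)"
      using e_le by (intro sum_mono) (simp add: pos_le_divide_eq mult.commute)
    also have "\<dots> = B i"
      by simp
    finally show "(\<Sum>k\<in>{j * 2 ^ Suc i..<Suc j * 2 ^ Suc i}. e i k) \<le> B i" .
  qed (use assms in auto)
  also have "\<dots> = (G 0 + (\<Sum>i<m. G (Suc i))) + 3 * (\<Sum>i<m. G i) + (\<Sum>i<m. B i)"
    by (simp add: sum.distrib sum_distrib_left)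
  also have "G 0 + (\<Sum>i<m. G (Suc i)) = (\<Sum>i\<le>m. G i)"
    unfolding lessThan_Suc_atMost[symmetric] sum.lessThan_Suc_shift ..
  also have "3 * (\<Sum>i<m. G i) \<le> 3 * (\<Sum>i\<le>m. G i)"
    by (intro mult_left_mono sum_mono2) (auto simp: G_def block_energy_nonneg)
  also have "(\<Sum>i<m. B i) = 2 * C * 2 powr (m / p) * (\<Sum>i<m. (2 powr (- (2 - p))) ^ (m - i) * tail_moment (level m i))"
    by (simp add: B_def sum_distrib_left ac_simps)
  finally show ?thesis by (simp add: G_def atLeast0LessThan)
qed

text \<open>If the top truncation is inactive, the original partial sum differs from the truncated one only by the
means of the excesses above the top level. These supply the summand \<open>l = 0\<close> of \<open>bias m\<close>, which is
missing from the chaining.\<close>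

lemma partial_sum_le:
  assumes trunc: "\<And>k. k < 2 ^ m \<Longrightarrow> Z k \<omega> \<le> 2 powr (m / p)" and "n \<le> 2 ^ m"
  shows "\<bar>\<Sum>k<n. Z k \<omega> - expectation (Z k)\<bar>
    \<le> 2 powr (m / p) * (4 * sqrt (weighted_energy m \<omega> / (1 - 2 powr (- (2 - p) / 2))) + 2 * C * bias m)"
proof -
  define E where "E k = expectation (\<lambda>\<omega>. Z k \<omega> - min (Z k \<omega>) (level m m))" for k
  have E_nonneg: "0 \<le> E k" for k
    unfolding E_def by (intro integral_nonneg_AE) auto
  have E_eq: "E k = expectation (Z k) - expectation (\<lambda>\<omega>. min (Z k \<omega>) (level m m))" for k
    unfolding E_def by (intro Bochner_Integration.integral_diff integrable_Z integrable_truncation level_pos)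
  have "(\<Sum>k<n. Z k \<omega> - expectation (Z k)) = (\<Sum>k<n. centred (level m m) k \<omega> - E k)"
    using trunc \<open>n \<le> 2 ^ m\<close> by (intro sum.cong) (auto simp: centred_def E_eq level_def min_absorb1)
  also have "\<bar>\<dots>\<bar> \<le> \<bar>\<Sum>k<n. centred (level m m) k \<omega>\<bar> + (\<Sum>k<n. E k)"
    using sum_nonneg[of "{..<n}" E] E_nonneg by (simp add: sum_subtractf)
  also have "(\<Sum>k<n. E k) \<le> (\<Sum>k<2 ^ m. E k)"
    using \<open>n \<le> 2 ^ m\<close> E_nonneg by (intro sum_mono2) auto
  also have "\<dots> \<le> (\<Sum>k<(2::nat) ^ m. C * 2 powr (m / p) * tail_moment (level m m) / 2 ^ m)"
    using level_excess_le[of m m] by (intro sum_mono) (simp add: E_def pos_le_divide_eq mult.commute mult.assoc)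
  also have "\<dots> = C * 2 powr (m / p) * tail_moment (level m m)"
    by simp
  also have "\<dots> \<le> 2 * C * 2 powr (m / p) * tail_moment (level m m)"
    using C_nonneg tail_moment_nonneg[of "level m m"] by simp
  also have "\<bar>\<Sum>k<n. centred (level m m) k \<omega>\<bar>
      \<le> 4 * (2 powr (m / p) * sqrt (weighted_energy m \<omega> / (1 - 2 powr (- (2 - p) / 2))))
      + 2 * C * 2 powr (m / p) * (\<Sum>i<m. (2 powr (- (2 - p))) ^ (m - i) * tail_moment (level m i))"
    using truncated_partial_sum_le[OF \<open>n \<le> 2 ^ m\<close>, of \<omega>] sum_sqrt_block_energy_le[of m \<omega>] by linarith
  finally have "\<bar>\<Sum>k<n. Z k \<omega> - expectation (Z k)\<bar>
     \<le> 4 * (2 powr (m / p) * sqrt (weighted_energy m \<omega> / (1 - 2 powr (- (2 - p) / 2))))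
      + 2 * C * 2 powr (m / p) * ((\<Sum>i<m. (2 powr (- (2 - p))) ^ (m - i) * tail_moment (level m i))
         + tail_moment (level m m))"
    by (simp add: distrib_left)
  also have "(\<Sum>i<m. (2 powr (- (2 - p))) ^ (m - i) * tail_moment (level m i)) + tail_moment (level m m) = bias m"
    unfolding sum_level_excess[symmetric] lessThan_Suc_atMost[symmetric] by simp
  finally show ?thesis by (simp add: algebra_simps)
qed

text \<open>From some index \<open>k0\<close> on, \<open>Z k\<close> is at most \<open>(k + 1) powr (1 / p)\<close>, which is at most \<open>2 powr (m / p)\<close> for
\<open>k < 2 ^ m\<close>. The finitely many earlier variables are below this level for all large \<open>m\<close>.\<close>

lemma AE_eventually_block_truncated:
  "AE \<omega> in M. eventually (\<lambda>m. \<forall>k<2 ^ m. Z k \<omega> \<le> 2 powr (m / p)) sequentially"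
  using AE_eventually_Z_le
proof eventually_elim
  case (elim \<omega>)
  then obtain k0 where k0: "Z k \<omega> \<le> real (Suc k) powr (1 / p)" if "k \<ge> k0" for k
    by (auto simp: eventually_sequentially)
  define B where "B = Max (insert 0 ((\<lambda>k. Z k \<omega>) ` {..<k0}))"
  have B: "Z k \<omega> \<le> B" if "k < k0" for k
    unfolding B_def using that by (intro Max_ge) auto
  have "filterlim (\<lambda>m. 2 powr (real m / p)) at_top sequentially"
    using p by real_asymp
  then have "eventually (\<lambda>m. B \<le> 2 powr (real m / p)) sequentially"
    by (simp add: filterlim_at_top)
  then show ?case
  proof eventually_elim
    case (elim m)
    show ?case
    proof (intro allI impI)
      fix k :: nat
      assume "k < 2 ^ m"
      then have "real (Suc k) \<le> 2 powr m"
        using of_nat_mono[of "Suc k" "2 ^ m", where 'a=real] by (simp add: powr_realpow)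
      then have "real (Suc k) powr (1 / p) \<le> (2 powr m) powr (1 / p)"
        using p by (intro powr_mono2) auto
      then show "Z k \<omega> \<le> 2 powr (m / p)"
        using k0[of k] B[of k] elim by (cases "k < k0") (auto simp: powr_powr)
    qed
  qed
qed

text \<open>Each \<open>n\<close> lies in a dyadic interval \<open>2 ^ m \<le> n < 2 ^ (m + 1)\<close>; the bound for \<open>m + 1\<close> then costs only the
constant factor \<open>2 powr (1 / p)\<close>.\<close>

lemma strong_law:
  "AE \<omega> in M. (\<lambda>n. (\<Sum>k<n. Z k \<omega> - expectation (Z k)) / real n powr (1 / p)) \<longlonglongrightarrow> 0"
  using AE_eventually_block_truncated AE_weighted_energy_tendsto_0
proof eventually_elim
  case (elim \<omega>)
  define F where "F m = 4 * sqrt (weighted_energy m \<omega> / (1 - 2 powr (- (2 - p) / 2))) + 2 * C * bias m" for m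
  have "F \<longlonglongrightarrow> 4 * sqrt (0 / (1 - 2 powr (- (2 - p) / 2))) + 2 * C * 0"
  proof -
    have "2 powr (- (2 - p) / 2) < 1" using p by (simp add: powr_less_one)
    then show ?thesis unfolding F_def by (intro tendsto_intros elim bias_tendsto_0) auto
  qed
  then have F: "F \<longlonglongrightarrow> 0" by simp
  show ?case
  proof (rule LIMSEQ_I)
    fix \<epsilon> :: real
    assume "0 < \<epsilon>"
    have "eventually (\<lambda>m. F m < \<epsilon> / 2 powr (1 / p)) sequentially"
      using F \<open>0 < \<epsilon>\<close> by (intro order_tendstoD(2)[of F 0]) auto
    with elim(1) obtain m0 where m0: "\<And>m. m0 \<le> m \<Longrightarrow> F m < \<epsilon> / 2 powr (1 / p)"
      "\<And>m k. m0 \<le> m \<Longrightarrow> k < 2 ^ m \<Longrightarrow> Z k \<omega> \<le> 2 powr (m / p)"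
      using eventually_conj[OF elim(1)] unfolding eventually_sequentially by metis
    show "\<exists>n0. \<forall>n\<ge>n0. norm ((\<Sum>k<n. Z k \<omega> - expectation (Z k)) / real n powr (1 / p) - 0) < \<epsilon>"
    proof (intro exI allI impI)
      fix n :: nat
      assume n: "2 ^ m0 \<le> n"
      then have "1 \<le> n" by (meson one_le_numeral one_le_power order_trans)
      then obtain m where m: "2 ^ m \<le> n" "n < 2 ^ (m + 1)"
        using ex_power_ivl1[of 2 n] by auto
      have "(2::nat) ^ m0 < 2 ^ Suc m" using n m by simp
      then have "m0 \<le> Suc m" by (meson nat_power_less_imp_less less_imp_le pos2)
      have "real n powr (1 / p) \<ge> (2 powr m) powr (1 / p)"
        using m(1) p of_nat_mono[of "2 ^ m" n, where 'a=real]
        by (intro powr_mono2) (auto simp: powr_realpow)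
      then have npos: "2 powr (Suc m / p) \<le> 2 powr (1 / p) * real n powr (1 / p)"
        by (simp add: powr_powr add_divide_distrib powr_add)
      have "\<bar>\<Sum>k<n. Z k \<omega> - expectation (Z k)\<bar> \<le> 2 powr (Suc m / p) * F (Suc m)"
        unfolding F_def using m(2) m0(2)[OF \<open>m0 \<le> Suc m\<close>] by (intro partial_sum_le) auto
      also have "\<dots> < 2 powr (Suc m / p) * (\<epsilon> / 2 powr (1 / p))"
        using m0(1)[OF \<open>m0 \<le> Suc m\<close>] by (intro mult_strict_left_mono) auto
      also have "\<dots> \<le> (2 powr (1 / p) * real n powr (1 / p)) * (\<epsilon> / 2 powr (1 / p))"
        using npos \<open>0 < \<epsilon>\<close> by (intro mult_right_mono) auto
      finally have "\<bar>\<Sum>k<n. Z k \<omega> - expectation (Z k)\<bar> < \<epsilon> * real n powr (1 / p)"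
        by (simp add: mult.commute)
      then show "norm ((\<Sum>k<n. Z k \<omega> - expectation (Z k)) / real n powr (1 / p) - 0) < \<epsilon>"
        using \<open>1 \<le> n\<close> by (simp add: pos_divide_less_eq)
    qed
  qed
qed

end

section \<open>Pairwise NQD sequences\<close>

lemma truncated_positive_part_eq_ramp: "0 \<le> t \<Longrightarrow> min (max x 0) t = ramp 0 t x"
  by (auto simp: ramp_def min_def max_def)

lemma truncated_negative_part_eq_ramp: "0 \<le> t \<Longrightarrow> min (max (- x) 0) t = t - ramp (- t) 0 x"
  by (auto simp: ramp_def min_def max_def)

lemma LogLog_ge_1: "1 \<le> LogLog x"
proof -
  have "exp 1 \<le> ln (max x (exp (exp 1)))"
    by (subst ln_exp[symmetric], rule ln_mono) auto
  then have "ln (exp 1) \<le> ln (ln (max x (exp (exp 1))))"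
    by (intro ln_mono) (auto intro: less_le_trans[OF exp_gt_zero])
  then show ?thesis by (simp add: LogLog_def)
qed

text \<open>The Marcinkiewicz-Zygmund strong law, obtained as the difference of the strong laws for the positive and
the negative parts. The sequences are shifted by one index so that they start at \<open>0\<close>.\<close>

theorem marcinkiewicz_zygmund_pairwise_NQD:
  fixes M :: "'a measure" and X :: "nat \<Rightarrow> 'a \<Rightarrow> real" and Y :: "'a \<Rightarrow> real" and p :: real
  assumes "prob_space M"
    and p: "1 < p" "p < 2"
    and X: "\<And>n. n \<ge> 1 \<Longrightarrow> X n \<in> borel_measurable M"
    and Y [measurable]: "Y \<in> borel_measurable M"
    and nqd: "pairwise_NQD M X"
    and dom: "stochastically_dominated M X Y"
    and moment: "integrable M (\<lambda>\<omega>. \<bar>Y \<omega>\<bar> powr p)"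
  shows "AE \<omega> in M. (\<lambda>n. (\<Sum>k=1..n. X k \<omega> - integral\<^sup>L M (X k)) / real n powr (1 / p)) \<longlonglongrightarrow> 0"
proof -
  interpret prob_space M by fact
  have X_meas [measurable]: "X (Suc k) \<in> borel_measurable M" for k
    by (rule X) simp
  obtain C where "0 < C" and C: "\<And>t. 0 < t \<Longrightarrow>
      (SUP n\<in>{1..}. \<P>(\<omega> in M. \<bar>X n \<omega>\<bar> > t)) \<le> C * \<P>(\<omega> in M. \<bar>Y \<omega>\<bar> > t)"
    using dom unfolding stochastically_dominated_def by blast
  have tail: "\<P>(\<omega> in M. t < \<bar>X (Suc k) \<omega>\<bar>) \<le> C * \<P>(\<omega> in M. t < \<bar>Y \<omega>\<bar>)" if "0 < t" for k t
  proof -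
    have "\<P>(\<omega> in M. t < \<bar>X (Suc k) \<omega>\<bar>) \<le> (SUP n\<in>{1..}. \<P>(\<omega> in M. t < \<bar>X n \<omega>\<bar>))"
      by (intro cSUP_upper bdd_aboveI2[where M=1]) auto
    then show ?thesis using C[OF that] by simp
  qed
  have part_tail: "\<P>(\<omega> in M. t < W \<omega>) \<le> C * \<P>(\<omega> in M. t < \<bar>Y \<omega>\<bar>)"
    if "0 < t" and W: "\<And>\<omega>. W \<omega> \<le> \<bar>X (Suc k) \<omega>\<bar>" for k t W
  proof -
    have "\<P>(\<omega> in M. t < W \<omega>) \<le> \<P>(\<omega> in M. t < \<bar>X (Suc k) \<omega>\<bar>)"
      by (rule finite_measure_mono) (auto intro: less_le_trans W)
    then show ?thesis using tail[OF \<open>0 < t\<close>, of k] by linarith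
  qed
  \<comment> \<open>ramps on the positive axis serve the positive parts, those on the negative axis the negative parts\<close>
  have cov: "expectation (\<lambda>\<omega>. ramp a b (X (Suc j) \<omega>) * ramp a b (X (Suc k) \<omega>))
       \<le> expectation (\<lambda>\<omega>. ramp a b (X (Suc j) \<omega>)) * expectation (\<lambda>\<omega>. ramp a b (X (Suc k) \<omega>))"
    if "j \<noteq> k" "a \<le> b" for j k a b
    using nqd that unfolding pairwise_NQD_def by (intro nqd_ramp_covariance) auto
  interpret pos: dominated_truncation_nqd M "\<lambda>k \<omega>. max (X (Suc k) \<omega>) 0" "\<lambda>\<omega>. \<bar>Y \<omega>\<bar>" C p
  proof
    show "0 \<le> C" using \<open>0 < C\<close> by simp
  next
    fix k :: nat and t :: real
    assume "0 < t"
    then show "\<P>(\<omega> in M. t < max (X (Suc k) \<omega>) 0) \<le> C * \<P>(\<omega> in M. t < \<bar>Y \<omega>\<bar>)"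
      by (rule part_tail[of t _ k]) auto
  next
    fix j k :: nat and t :: real
    assume "j \<noteq> k" "0 < t"
    then show "expectation (\<lambda>\<omega>. min (max (X (Suc j) \<omega>) 0) t * min (max (X (Suc k) \<omega>) 0) t)
        \<le> expectation (\<lambda>\<omega>. min (max (X (Suc j) \<omega>) 0) t) * expectation (\<lambda>\<omega>. min (max (X (Suc k) \<omega>) 0) t)"
      using cov[of j k 0 t] by (simp add: truncated_positive_part_eq_ramp)
  qed (use p moment in auto)
  interpret neg: dominated_truncation_nqd M "\<lambda>k \<omega>. max (- X (Suc k) \<omega>) 0" "\<lambda>\<omega>. \<bar>Y \<omega>\<bar>" C p
  proof
    show "0 \<le> C" using \<open>0 < C\<close> by simp
  next
    fix k :: nat and t :: real
    assume "0 < t"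
    then show "\<P>(\<omega> in M. t < max (- X (Suc k) \<omega>) 0) \<le> C * \<P>(\<omega> in M. t < \<bar>Y \<omega>\<bar>)"
      by (rule part_tail[of t _ k]) auto
  next
    fix j k :: nat and t :: real
    assume "j \<noteq> k" "0 < t"
    then show "expectation (\<lambda>\<omega>. min (max (- X (Suc j) \<omega>) 0) t * min (max (- X (Suc k) \<omega>) 0) t)
        \<le> expectation (\<lambda>\<omega>. min (max (- X (Suc j) \<omega>) 0) t) * expectation (\<lambda>\<omega>. min (max (- X (Suc k) \<omega>) 0) t)"
      using cov[of j k "- t" 0]
      by (simp add: truncated_negative_part_eq_ramp left_diff_distrib right_diff_distrib
          integrable_ramp integrable_ramp_mult prob_space)
  qed (use p moment in auto)
  have int: "expectation (X (Suc k)) = expectation (\<lambda>\<omega>. max (X (Suc k) \<omega>) 0) - expectation (\<lambda>\<omega>. max (- X (Suc k) \<omega>) 0)" for k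
    by (subst Bochner_Integration.integral_diff[symmetric, OF pos.integrable_Z neg.integrable_Z])
       (auto intro!: Bochner_Integration.integral_cong)
  show ?thesis
    using pos.strong_law neg.strong_law
  proof eventually_elim
    case (elim \<omega>)
    have "(\<Sum>k=1..n. X k \<omega> - expectation (X k)) / real n powr (1 / p)
       = (\<Sum>k<n. max (X (Suc k) \<omega>) 0 - expectation (\<lambda>\<omega>. max (X (Suc k) \<omega>) 0)) / real n powr (1 / p)
       - (\<Sum>k<n. max (- X (Suc k) \<omega>) 0 - expectation (\<lambda>\<omega>. max (- X (Suc k) \<omega>) 0)) / real n powr (1 / p)" for n
    proof -
      have "(\<Sum>k=1..n. X k \<omega> - expectation (X k)) = (\<Sum>k<n. X (Suc k) \<omega> - expectation (X (Suc k)))"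
        by (rule sum.reindex_bij_witness[where i=Suc and j="\<lambda>k. k - 1"]) auto
      also have "\<dots> = (\<Sum>k<n. (max (X (Suc k) \<omega>) 0 - expectation (\<lambda>\<omega>. max (X (Suc k) \<omega>) 0))
          - (max (- X (Suc k) \<omega>) 0 - expectation (\<lambda>\<omega>. max (- X (Suc k) \<omega>) 0)))"
        by (intro sum.cong) (auto simp: int max_def)
      finally show ?thesis by (simp add: sum_subtractf diff_divide_distrib)
    qed
    then show ?case
      using tendsto_diff[OF elim] by simp
  qed
qed

theorem corollary1:
  fixes M :: "'a measure"
    and X :: "nat \<Rightarrow> 'a \<Rightarrow> real"
    and Y :: "'a \<Rightarrow> real"
    and p :: real
  assumes "prob_space M"
    and "1 < p" and "p < 2"
    and "\<And>n. n \<ge> 1 \<Longrightarrow> X n \<in> borel_measurable M"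
    and "Y \<in> borel_measurable M"
    and "pairwise_NQD M X"
    and "stochastically_dominated M X Y"
    and "integrable M (\<lambda>\<omega>. \<bar>Y \<omega>\<bar> powr p)"
  shows "AE \<omega> in M.
    (\<lambda>n. 1 / (real n powr (1 / p) * LogLog (real n) powr (2 * (p - 1) / p))
           * (\<Sum>k=1..n. X k \<omega> - integral\<^sup>L M (X k))) \<longlonglongrightarrow> 0"
proof -
  have "AE \<omega> in M. (\<lambda>n. (\<Sum>k=1..n. X k \<omega> - integral\<^sup>L M (X k)) / real n powr (1 / p)) \<longlonglongrightarrow> 0"
    by (rule marcinkiewicz_zygmund_pairwise_NQD[where Y=Y]) (use assms in auto)
  then show ?thesis
  proof eventually_elim
    case (elim \<omega>)
    let ?s = "\<lambda>n. (\<Sum>k=1..n. X k \<omega> - integral\<^sup>L M (X k)) / real n powr (1 / p)"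
    show ?case
    proof (rule Lim_null_comparison)
      show "(\<lambda>n. \<bar>?s n\<bar>) \<longlonglongrightarrow> 0" using elim by (rule tendsto_rabs_zero)
      have "norm (1 / (real n powr (1 / p) * LogLog (real n) powr (2 * (p - 1) / p))
             * (\<Sum>k=1..n. X k \<omega> - integral\<^sup>L M (X k))) \<le> \<bar>?s n\<bar>" for n
      proof -
        let ?L = "LogLog (real n) powr (2 * (p - 1) / p)"
        have "1 \<le> ?L"
          using LogLog_ge_1[of "real n"] \<open>1 < p\<close> by (intro ge_one_powr_ge_zero) auto
        have "norm (1 / (real n powr (1 / p) * ?L) * (\<Sum>k=1..n. X k \<omega> - integral\<^sup>L M (X k))) = \<bar>?s n\<bar> / ?L"
          by (simp add: abs_mult abs_divide)
        also have "\<dots> \<le> \<bar>?s n\<bar> / 1"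
          using \<open>1 \<le> ?L\<close> by (intro divide_left_mono) auto
        finally show ?thesis by simp
      qed
      then show "\<forall>\<^sub>F n in sequentially. norm (1 / (real n powr (1 / p) * LogLog (real n) powr (2 * (p - 1) / p))
             * (\<Sum>k=1..n. X k \<omega> - integral\<^sup>L M (X k))) \<le> \<bar>?s n\<bar>"
        by simp
    qed
  qed
qed

end
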